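(* The square lattice $B_n$ occurs as a minor of a planar primitive divergent graph in $\phi^4$ with the same number of vertices as $B_n$, namely $n^2$ (i.e. with $n^2-1$ loops).
   Context: Graphs are finite undirected multigraphs; $e_G$ is the number of edges and $h_G$ (the loop number) the number of independent cycles of $G$. A subgraph is defined by a subset of the edges. $G$ is primitive divergent if $e_G=2h_G$ and $e_\gamma>2h_\gamma$ for every strict (non-empty) subgraph $\gamma\subsetneq G$. $G$ is in $\phi^4$ if every vertex has degree at most $4$. A minor of $G$ is a graph obtained by deleting and contracting edges. $B_n$ is the $n\times n$ square grid graph: it has $n^2$ vertices, in which interior vertices have degree 4, non-corner boundary vertices degree 3, and the four corners degree 2. *)

theory Defs
  imports
    "HOL-Analysis.Analysis"
    "HOL-Library.Function_Algebras"
    "HOL-Library.Z2"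
begin

text \<open>The set \<open>ends G e\<close> has two elements for an ordinary edge and one element for a self-loop.
  Values of \<open>ends G\<close> outside \<open>edges G\<close> are irrelevant.\<close>

record ('v, 'e) mgraph =
  verts :: "'v set"
  edges :: "'e set"
  ends :: "'e \<Rightarrow> 'v set"

definition multigraph :: "('v, 'e) mgraph \<Rightarrow> bool" where
  "multigraph G \<longleftrightarrow> finite (verts G) \<and> finite (edges G) \<and>
     (\<forall>e \<in> edges G. ends G e \<subseteq> verts G \<and> card (ends G e) \<in> {1, 2})"

definition degree :: "('v, 'e) mgraph \<Rightarrow> 'v \<Rightarrow> nat" where
  "degree G v = card {e \<in> edges G. v \<in> ends G e} + card {e \<in> edges G. ends G e = {v}}"

definition iso :: "('v, 'e) mgraph \<Rightarrow> ('w, 'f) mgraph \<Rightarrow> bool" where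
  "iso G H \<longleftrightarrow> (\<exists>\<phi> \<psi>. bij_betw \<phi> (verts G) (verts H) \<and> bij_betw \<psi> (edges G) (edges H) \<and>
     (\<forall>e \<in> edges G. ends H (\<psi> e) = \<phi> ` ends G e))"

definition subgraph :: "('v, 'e) mgraph \<Rightarrow> 'e set \<Rightarrow> ('v, 'e) mgraph" where
  "subgraph G F = G\<lparr>verts := \<Union> (ends G ` F), edges := F\<rparr>"

text \<open>Edge sets are identified with their indicator functions, which form a vector space over the
  field with two elements. The cycle space is the kernel of the boundary map on 1-chains; a
  self-loop has boundary zero, hence the restriction to edges with two distinct end points.\<close>

interpretation chain: vector_space "\<lambda>(c :: bit) (f :: 'e \<Rightarrow> bit) e. c * f e"
  by unfold_locales (auto simp: fun_eq_iff algebra_simps)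

definition cycle_space :: "('v, 'e) mgraph \<Rightarrow> ('e \<Rightarrow> bit) set" where
  "cycle_space G = {f. (\<forall>e. e \<notin> edges G \<longrightarrow> f e = 0) \<and>
     (\<forall>v \<in> verts G. (\<Sum>e | e \<in> edges G \<and> v \<in> ends G e \<and> ends G e \<noteq> {v}. f e) = 0)}"

definition loop_number :: "('v, 'e) mgraph \<Rightarrow> nat" where
  "loop_number G = chain.dim (cycle_space G)"

definition primitive_divergent :: "('v, 'e) mgraph \<Rightarrow> bool" where
  "primitive_divergent G \<longleftrightarrow> card (edges G) = 2 * loop_number G \<and>
     (\<forall>F. F \<noteq> {} \<and> F \<subset> edges G \<longrightarrow> card F > 2 * loop_number (subgraph G F))"

definition in_phi4 :: "('v, 'e) mgraph \<Rightarrow> bool" where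
  "in_phi4 G \<longleftrightarrow> (\<forall>v \<in> verts G. degree G v \<le> 4)"

text \<open>A drawing in the plane: since a simple path is injective except that its two end points may
  coincide, the curve of an ordinary edge is an arc and that of a self-loop is a simple closed
  curve.\<close>

definition planar :: "('v, 'e) mgraph \<Rightarrow> bool" where
  "planar G \<longleftrightarrow> (\<exists>(p :: 'v \<Rightarrow> complex) (\<gamma> :: 'e \<Rightarrow> real \<Rightarrow> complex).
     inj_on p (verts G) \<and>
     (\<forall>e \<in> edges G. simple_path (\<gamma> e) \<and>
        {pathstart (\<gamma> e), pathfinish (\<gamma> e)} = p ` ends G e \<and>
        path_image (\<gamma> e) \<inter> p ` verts G = p ` ends G e) \<and>
     (\<forall>e \<in> edges G. \<forall>f \<in> edges G. e \<noteq> f \<longrightarrow>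
        path_image (\<gamma> e) \<inter> path_image (\<gamma> f) = p ` (ends G e \<inter> ends G f)))"

definition delete_edge :: "('v, 'e) mgraph \<Rightarrow> 'e \<Rightarrow> ('v, 'e) mgraph" where
  "delete_edge G e = G\<lparr>edges := edges G - {e}\<rparr>"

text \<open>Contraction of an edge with end points \<open>u\<close> and \<open>v\<close>: the vertex \<open>u\<close> is merged into \<open>v\<close>.
  Edges parallel to \<open>e\<close> become self-loops.\<close>

definition contract_edge :: "('v, 'e) mgraph \<Rightarrow> 'e \<Rightarrow> 'v \<Rightarrow> 'v \<Rightarrow> ('v, 'e) mgraph" where
  "contract_edge G e u v =
     (let r = (\<lambda>x. if x = u then v else x)
      in G\<lparr>verts := r ` verts G, edges := edges G - {e}, ends := (\<lambda>f. r ` ends G f)\<rparr>)"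

inductive minor :: "('v, 'e) mgraph \<Rightarrow> ('v, 'e) mgraph \<Rightarrow> bool" for G where
  refl: "minor G G"
| delete: "minor G H \<Longrightarrow> e \<in> edges H \<Longrightarrow> minor G (delete_edge H e)"
| contract: "minor G H \<Longrightarrow> e \<in> edges H \<Longrightarrow> ends H e = {u, v} \<Longrightarrow> minor G (contract_edge H e u v)"

definition has_minor :: "('v, 'e) mgraph \<Rightarrow> ('w, 'f) mgraph \<Rightarrow> bool" where
  "has_minor G K \<longleftrightarrow> (\<exists>H. minor G H \<and> iso H K)"

definition grid :: "nat \<Rightarrow> (nat \<times> nat, (nat \<times> nat) set) mgraph" where
  "grid n = \<lparr>verts = {..<n} \<times> {..<n},
     edges = {{(i, j), (Suc i, j)} | i j. Suc i < n \<and> j < n} \<union>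
             {{(i, j), (i, Suc j)} | i j. i < n \<and> Suc j < n},
     ends = (\<lambda>e. e)\<rparr>"

end

theory Submission
  imports Defs
begin

text \<open>Call a loopless graph tight if it has \<open>2|V| - 2\<close> edges while every proper vertex subset \<open>S\<close>
  with at least two elements spans at most \<open>2|S| - 3\<close> edges. Since a connected graph satisfies
  \<open>h = e - v + 1\<close>, applying this to the connected components of a subgraph shows that tight graphs
  are primitive divergent.

  For \<open>n \<ge> 3\<close> add to the grid \<open>2n - 2\<close> chords in its outer face. Give each boundary vertex one
  stub and each corner two, so that every row and every column of the grid is a line with a stub at
  both ends; number the stubs along the left and bottom sides and those along the top and right sides
  from \<open>0\<close> to \<open>2n - 1\<close>, both starting at the corner \<open>(0, 0)\<close>, and join the \<open>k\<close>-th stub of the first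
  kind to stub \<open>k + 2\<close> of the second. A vertex set \<open>S\<close> spans \<open>2|S|\<close> edges, minus the number of maximal
  runs of \<open>S\<close> in the rows and columns, plus the number of chords inside \<open>S\<close>; so for
  the sets \<open>S\<close> above the chords inside \<open>S\<close> must be at least three fewer than the runs. For \<open>n = 2\<close> the graph is \<open>K\<^sub>4\<close>.

  The chords wrap around the grid like parallel strands on a cylinder. In the coordinates
  \<open>(j - i, i + j)\<close> of the vertex \<open>(i, j)\<close>, taken modulo \<open>4n\<close> in the first component, all edges are
  straight segments, and the exponential function maps this cylinder into the plane.\<close>

section \<open>The cycle space\<close>

text \<open>These rules turn arithmetic in the two-element field into bitwise operations, out of reach of
  the rules for rings.\<close>

declare add_bit_eq_xor [simp del] mult_bit_eq_and [simp del] minus_bit_def [simp del]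

definition edge_chains :: "'e set \<Rightarrow> ('e \<Rightarrow> bit) set" where
  "edge_chains E = {f. \<forall>e. e \<notin> E \<longrightarrow> f e = 0}"

definition boundary :: "('v, 'e) mgraph \<Rightarrow> ('e \<Rightarrow> bit) \<Rightarrow> 'v \<Rightarrow> bit" where
  "boundary G f v = (\<Sum>e | e \<in> edges G \<and> v \<in> ends G e \<and> ends G e \<noteq> {v}. f e)"

lemma cycle_space_altdef:
  "cycle_space G = {f \<in> edge_chains (edges G). \<forall>v \<in> verts G. boundary G f v = 0}"
  by (auto simp: cycle_space_def edge_chains_def boundary_def)

lemma boundary_add: "boundary G (f + g) v = boundary G f v + boundary G g v"
  by (simp add: boundary_def sum.distrib)

lemma boundary_diff: "boundary G (f - g) v = boundary G f v - boundary G g v"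
  by (simp only: boundary_def minus_apply sum_subtractf)

lemma boundary_0: "boundary G 0 v = 0"
  by (simp add: boundary_def)

lemma boundary_sum: "boundary G (\<Sum>i\<in>I. f i) v = (\<Sum>i\<in>I. boundary G (f i) v)"
proof (induction I rule: infinite_finite_induct)
  case (insert i I)
  then show ?case by (simp only: sum.insert boundary_add not_False_eq_True simp_thms)
qed (simp_all only: sum.infinite sum.empty boundary_0 not_False_eq_True simp_thms)

lemma edge_chains_add: "f \<in> edge_chains E \<Longrightarrow> g \<in> edge_chains E \<Longrightarrow> f + g \<in> edge_chains E"
  by (auto simp: edge_chains_def)

lemma edge_chains_diff: "f \<in> edge_chains E \<Longrightarrow> g \<in> edge_chains E \<Longrightarrow> f - g \<in> edge_chains E"
  by (auto simp: edge_chains_def)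

lemma edge_chains_sum: "(\<And>i. i \<in> I \<Longrightarrow> f i \<in> edge_chains E) \<Longrightarrow> (\<Sum>i\<in>I. f i) \<in> edge_chains E"
  by (induction I rule: infinite_finite_induct) (auto simp: edge_chains_def)

section \<open>Counting chains and cycles\<close>

lemma card_edge_chains:
  assumes "finite E"
  shows "finite (edge_chains E) \<and> card (edge_chains E) = 2 ^ card E"
proof -
  have "bij_betw (\<lambda>F e. of_bool (e \<in> F) :: bit) (Pow E) (edge_chains E)"
  proof (rule bij_betw_byWitness[where f' = "\<lambda>f. {e. f e = 1}"])
    show "\<forall>f\<in>edge_chains E. (\<lambda>e. of_bool (e \<in> {e. f e = 1})) = f"
      by (auto simp: fun_eq_iff)
  qed (auto simp: edge_chains_def)
  with assms show ?thesis
    using bij_betw_finite[of _ "Pow E" "edge_chains E"] bij_betw_same_card[of _ "Pow E" "edge_chains E"]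
    by (simp add: card_Pow)
qed

text \<open>With only the scalars 0 and 1, adjoining an independent vector \<open>b\<close> turns
  the span into the disjoint union of itself and its translate by \<open>b\<close>, so its size
  doubles.\<close>

lemma card_span_independent:
  fixes B :: "('e \<Rightarrow> bit) set"
  assumes "finite B" "chain.independent B"
  shows "finite (chain.span B) \<and> card (chain.span B) = 2 ^ card B"
  using assms
proof (induction B rule: finite_induct)
  case empty
  show ?case by (simp only: chain.span_empty) simp
next
  case (insert b B)
  have ind: "chain.independent B" and b: "b \<notin> chain.span B"
    using insert.prems insert.hyps by (simp_all add: chain.independent_insert)
  have *: "chain.span (insert b B) = chain.span B \<union> (\<lambda>x. x + b) ` chain.span B"
  proof (intro equalityI subsetI)
    fix x assume "x \<in> chain.span (insert b B)"
    then obtain k :: bit where k: "x - (\<lambda>e. k * b e) \<in> chain.span B"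
      by (auto simp: chain.span_insert)
    show "x \<in> chain.span B \<union> (\<lambda>x. x + b) ` chain.span B"
    proof (cases "k = 0")
      case True
      with k show ?thesis by (simp add: fun_diff_def)
    next
      case False
      with k have "x - b \<in> chain.span B" by (simp add: fun_diff_def)
      then have "(x - b) + b \<in> (\<lambda>x. x + b) ` chain.span B" by blast
      then show ?thesis by simp
    qed
  next
    fix x assume "x \<in> chain.span B \<union> (\<lambda>x. x + b) ` chain.span B"
    moreover have "chain.span B \<subseteq> chain.span (insert b B)"
      by (rule chain.span_mono) auto
    moreover have "b \<in> chain.span (insert b B)" by (rule chain.span_base) simp
    ultimately show "x \<in> chain.span (insert b B)"
      using chain.span_add by blast
  qed
  have disj: "chain.span B \<inter> (\<lambda>x. x + b) ` chain.span B = {}"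
    using b chain.span_add_eq by fastforce
  have "card ((\<lambda>x. x + b) ` chain.span B) = card (chain.span B)"
    by (intro card_image) (auto simp: inj_on_def)
  with * disj insert.IH[OF ind] insert.hyps show ?case
    by (simp add: card_Un_disjoint)
qed

text \<open>This trades dimensions for cardinalities: the rank inequalities below become injections
  between finite sets or counts of fibres.\<close>

lemma card_cycle_space:
  assumes "finite (edges G)"
  shows "finite (cycle_space G) \<and> card (cycle_space G) = 2 ^ loop_number G"
proof -
  have sub: "chain.subspace (cycle_space G)"
    by (auto simp: chain.subspace_def cycle_space_altdef edge_chains_def boundary_add boundary_0
          simp del: plus_fun_apply)
      (auto simp: boundary_def simp flip: sum_distrib_left)
  have fin: "finite (cycle_space G)"
    using card_edge_chains[OF assms] by (auto simp: cycle_space_altdef)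
  obtain B where B: "B \<subseteq> cycle_space G" "chain.independent B" "cycle_space G \<subseteq> chain.span B"
      "card B = chain.dim (cycle_space G)"
    using chain.basis_exists by blast
  have "chain.span B = cycle_space G"
    using B chain.span_minimal[OF B(1) sub] by auto
  with card_span_independent[of B] B fin show ?thesis
    by (auto simp: loop_number_def dest: finite_subset)
qed

text \<open>An ordinary edge contributes \<open>f e\<close> at both of its ends and a self-loop
  contributes nothing, so over the two-element field everything cancels.\<close>

lemma handshake:
  assumes "multigraph G"
  shows "(\<Sum>v\<in>verts G. boundary G f v) = 0"
proof -
  have fin: "finite (verts G)" "finite (edges G)"
    using assms by (auto simp: multigraph_def)
  have "(\<Sum>v\<in>verts G. boundary G f v) =
      (\<Sum>e\<in>edges G. \<Sum>v | v \<in> verts G \<and> v \<in> ends G e \<and> ends G e \<noteq> {v}. f e)"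
    unfolding boundary_def using fin
    by (intro sum.swap_restrict[of _ _ "\<lambda>v e. f e" "\<lambda>v e. v \<in> ends G e \<and> ends G e \<noteq> {v}"])
  also have "\<dots> = (\<Sum>e\<in>edges G. 0)"
  proof (rule sum.cong[OF HOL.refl])
    fix e assume "e \<in> edges G"
    then have e: "ends G e \<subseteq> verts G" "card (ends G e) \<in> {1, 2}"
      using assms by (auto simp: multigraph_def)
    show "(\<Sum>v | v \<in> verts G \<and> v \<in> ends G e \<and> ends G e \<noteq> {v}. f e) = 0"
    proof (cases "card (ends G e) = 1")
      case True
      then obtain a where "ends G e = {a}" by (auto simp: card_1_singleton_iff)
      then have "{v. v \<in> verts G \<and> v \<in> ends G e \<and> ends G e \<noteq> {v}} = {}" by auto
      then show ?thesis by (simp only: sum.empty)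
    next
      case False
      with e have "card (ends G e) = 2" by auto
      then obtain a b where "ends G e = {a, b}" "a \<noteq> b" by (auto simp: card_2_iff)
      with e have "{v. v \<in> verts G \<and> v \<in> ends G e \<and> ends G e \<noteq> {v}} = {a, b}" by auto
      with \<open>a \<noteq> b\<close> show ?thesis by simp
    qed
  qed
  finally show ?thesis by simp
qed

text \<open>By \<open>handshake\<close> the condition at \<open>r\<close> follows from those at the
  other vertices. This is the source of the summand 1 in \<open>loop_number_ge\<close>.\<close>

lemma cycle_space_drop_vertex:
  assumes "multigraph G" "r \<in> verts G"
  shows "cycle_space G = {f \<in> edge_chains (edges G). \<forall>v \<in> verts G - {r}. boundary G f v = 0}"
proof -
  have fin: "finite (verts G)" using assms by (simp add: multigraph_def)
  have "boundary G f r = 0" if "\<forall>v \<in> verts G - {r}. boundary G f v = 0" for f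
    using handshake[OF assms(1), of f] that by (simp add: sum.remove[OF fin assms(2)])
  then show ?thesis by (fastforce simp: cycle_space_altdef)
qed

text \<open>The chains with a prescribed boundary away from \<open>r\<close> differ by cycles, so
  each fibre has at most as many elements as the cycle space, and there are
  \<open>2 ^ (card (verts G) - 1)\<close> possible boundaries.\<close>

lemma loop_number_ge:
  assumes "multigraph G" "verts G \<noteq> {}"
  shows "card (edges G) + 1 \<le> loop_number G + card (verts G)"
proof -
  have fin: "finite (verts G)" "finite (edges G)"
    using assms by (auto simp: multigraph_def)
  obtain r where r: "r \<in> verts G" using assms by auto
  define sup where "sup f = {v \<in> verts G - {r}. boundary G f v = 1}" for f
  let ?C = "edge_chains (edges G)" and ?K = "cycle_space G" and ?P = "Pow (verts G - {r})"
  have K: "finite ?K" "card ?K = 2 ^ loop_number G"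
    using card_cycle_space[OF fin(2)] by auto
  have C: "finite ?C" "card ?C = 2 ^ card (edges G)"
    using card_edge_chains[OF fin(2)] by auto
  have fibre: "card {f \<in> ?C. sup f = A} \<le> card ?K" for A
  proof (cases "{f \<in> ?C. sup f = A} = {}")
    case False
    then obtain g where g: "g \<in> ?C" "sup g = A" by auto
    have "(\<lambda>f. f - g) ` {f \<in> ?C. sup f = A} \<subseteq> ?K"
    proof (rule image_subsetI)
      fix f assume "f \<in> {f \<in> ?C. sup f = A}"
      then have f: "f \<in> ?C" "sup f = sup g" using g by auto
      have "boundary G f v = boundary G g v" if "v \<in> verts G - {r}" for v
      proof -
        have "v \<in> sup f \<longleftrightarrow> v \<in> sup g" using f(2) by simp
        then have "boundary G f v = 1 \<longleftrightarrow> boundary G g v = 1"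
          using that by (simp only: sup_def mem_Collect_eq simp_thms)
        then show ?thesis by (cases "boundary G g v") simp_all
      qed
      then have "\<forall>v \<in> verts G - {r}. boundary G (f - g) v = 0" by (simp add: boundary_diff)
      then show "f - g \<in> ?K"
        unfolding cycle_space_drop_vertex[OF assms(1) r]
        using edge_chains_diff[OF f(1) g(1)] by (intro CollectI conjI)
    qed
    moreover have "inj_on (\<lambda>f. f - g) {f \<in> ?C. sup f = A}"
      by (rule inj_onI) (metis diff_add_cancel)
    ultimately show ?thesis by (intro card_inj_on_le[OF _ _ K(1)])
  next
    case True
    show ?thesis unfolding True by simp
  qed
  have "?C \<subseteq> (\<Union>A\<in>?P. {f \<in> ?C. sup f = A})"
  proof
    fix f assume "f \<in> ?C"
    moreover have "sup f \<in> ?P" unfolding sup_def by blast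
    ultimately show "f \<in> (\<Union>A\<in>?P. {f \<in> ?C. sup f = A})" by blast
  qed
  then have "card ?C \<le> card (\<Union>A\<in>?P. {f \<in> ?C. sup f = A})"
    using fin C by (intro card_mono) auto
  also have "\<dots> \<le> (\<Sum>A\<in>?P. card {f \<in> ?C. sup f = A})"
    using fin by (intro card_UN_le) auto
  also have "\<dots> \<le> (\<Sum>A\<in>?P. card ?K)" by (intro sum_mono fibre)
  also have "\<dots> = 2 ^ (card (verts G) - 1 + loop_number G)"
    using fin r by (simp add: card_Pow K power_add)
  finally have "card (edges G) \<le> card (verts G) - 1 + loop_number G"
    by (simp add: C)
  moreover have "card (verts G) > 0" using fin r by (auto simp: card_gt_0_iff)
  ultimately show ?thesis by simp
qed

text \<open>Connectedness is expressed by \<open>conn\<close>: a vertex set that contains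
  \<open>r\<close> and that no edge leaves is everything. It makes every set of vertices other than
  \<open>r\<close> the boundary, away from \<open>r\<close>, of some chain; adding cycles to these
  chains keeps them distinct.\<close>

lemma loop_number_le:
  assumes "multigraph G" "r \<in> verts G"
    and conn: "\<And>T. T \<subseteq> verts G \<Longrightarrow> r \<in> T \<Longrightarrow>
      (\<And>e. e \<in> edges G \<Longrightarrow> ends G e \<inter> T \<noteq> {} \<Longrightarrow> ends G e \<subseteq> T) \<Longrightarrow> T = verts G"
  shows "loop_number G + card (verts G) \<le> card (edges G) + 1"
proof -
  have fin: "finite (verts G)" "finite (edges G)"
    using assms by (auto simp: multigraph_def)
  let ?C = "edge_chains (edges G)" and ?K = "cycle_space G" and ?P = "Pow (verts G - {r})"
  have K: "finite ?K" "card ?K = 2 ^ loop_number G"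
    using card_cycle_space[OF fin(2)] by auto
  have C: "finite ?C" "card ?C = 2 ^ card (edges G)"
    using card_edge_chains[OF fin(2)] by auto
  \<comment> \<open>\<open>T\<close> consists of the vertices that some chain joins to
    \<open>r\<close>. For \<open>r\<close> itself the zero chain serves, as the boundary is tested
    only away from \<open>r\<close>.\<close>
  define T where "T = {v \<in> verts G. \<exists>x \<in> ?C. \<forall>w \<in> verts G - {r}. boundary G x w = of_bool (w = v)}"
  have "T = verts G"
  proof (rule conn)
    show "T \<subseteq> verts G" by (auto simp: T_def)
    have "0 \<in> ?C" by (simp add: edge_chains_def)
    moreover have "\<forall>w \<in> verts G - {r}. boundary G 0 w = of_bool (w = r)"
      by (simp add: boundary_0)
    ultimately show "r \<in> T" using assms(2) unfolding T_def by blast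
  next
    fix e assume e: "e \<in> edges G" "ends G e \<inter> T \<noteq> {}"
    then obtain a where a: "a \<in> ends G e" "a \<in> T" by auto
    have ends: "ends G e \<subseteq> verts G" "card (ends G e) \<in> {1, 2}"
      using e assms(1) by (auto simp: multigraph_def)
    show "ends G e \<subseteq> T"
    proof
      fix b assume b: "b \<in> ends G e"
      show "b \<in> T"
      proof (cases "a = b")
        case False
        with a b ends have "card (ends G e) = 2" by (auto simp: card_1_singleton_iff)
        with a b False have ab: "ends G e = {a, b}"
          by (auto simp: card_2_iff)
        obtain x where x: "x \<in> ?C" "\<And>w. w \<in> verts G - {r} \<Longrightarrow> boundary G x w = of_bool (w = a)"
          using a by (auto simp: T_def)
        \<comment> \<open>Adding the edge \<open>e\<close> to the chain moves its boundary point
          from \<open>a\<close> to \<open>b\<close>.\<close>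
        define d :: "'b \<Rightarrow> bit" where "d = (\<lambda>f. of_bool (f = e))"
        have d: "boundary G d w = of_bool (w = a \<or> w = b)" for w
          using fin e ab False by (auto simp: boundary_def d_def of_bool_def sum.If_cases)
        have "boundary G (x + d) w = of_bool (w = b)" if "w \<in> verts G - {r}" for w
          using x(2)[OF that] False by (auto simp: boundary_add d)
        moreover have "x + d \<in> ?C" using x e by (auto simp: edge_chains_def d_def)
        ultimately show ?thesis using b ends unfolding T_def by blast
      qed (use a in simp)
    qed
  qed
  then have "\<forall>v\<in>verts G. \<exists>x. x \<in> ?C \<and> (\<forall>w \<in> verts G - {r}. boundary G x w = of_bool (w = v))"
    unfolding T_def by blast
  then obtain x where x: "\<And>v. v \<in> verts G \<Longrightarrow> x v \<in> ?C"
    "\<And>v w. v \<in> verts G \<Longrightarrow> w \<in> verts G - {r} \<Longrightarrow> boundary G (x v) w = of_bool (w = v)"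
    by metis
  define X where "X A = (\<Sum>v\<in>A. x v)" for A
  have X: "boundary G (X A) w = of_bool (w \<in> A)" if "A \<in> ?P" "w \<in> verts G - {r}" for A w
  proof -
    have "finite A" using that fin by (auto dest: finite_subset)
    have "boundary G (X A) w = (\<Sum>v\<in>A. of_bool (w = v))"
      unfolding X_def boundary_sum using that x by (intro sum.cong) auto
    also have "\<dots> = of_bool (w \<in> A)" using \<open>finite A\<close> by (simp add: of_bool_def)
    finally show ?thesis .
  qed
  \<comment> \<open>The sum \<open>k + X A\<close> determines \<open>A\<close> as its boundary away
    from \<open>r\<close>, and then \<open>k\<close>.\<close>
  have bdk: "boundary G (k + X A) w = of_bool (w \<in> A)"
    if "k \<in> ?K" "A \<in> ?P" "w \<in> verts G - {r}" for k A w
    using that by (simp add: boundary_add X cycle_space_altdef)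
  have "inj_on (\<lambda>(k, A). k + X A) (?K \<times> ?P)"
  proof (rule inj_onI, clarify)
    fix k A k' A' assume *: "k \<in> ?K" "k' \<in> ?K" "k + X A = k' + X A'"
      "A \<subseteq> verts G - {r}" "A' \<subseteq> verts G - {r}"
    have "(w \<in> A) = (w \<in> A')" if "w \<in> verts G - {r}" for w
      using bdk[of k A w] bdk[of k' A' w] * that by (simp add: of_bool_def split: if_splits)
    with * have "A = A'" by blast
    with * show "k = k' \<and> A = A'" by simp
  qed
  moreover have "(\<lambda>(k, A). k + X A) ` (?K \<times> ?P) \<subseteq> ?C"
    using x(1) by (auto intro!: edge_chains_add edge_chains_sum simp: X_def cycle_space_altdef)
  ultimately have "card (?K \<times> ?P) \<le> card ?C"
    using C by (metis card_inj_on_le)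
  also have "card (?K \<times> ?P) = 2 ^ (loop_number G + (card (verts G) - 1))"
    using fin assms(2) by (simp add: card_cartesian_product K card_Pow power_add)
  finally have "loop_number G + (card (verts G) - 1) \<le> card (edges G)"
    by (simp add: C)
  moreover have "card (verts G) > 0" using fin assms(2) by (auto simp: card_gt_0_iff)
  ultimately show ?thesis by simp
qed

section \<open>Tight graphs are primitive divergent\<close>

definition tight :: "('v, 'e) mgraph \<Rightarrow> bool" where
  "tight G \<longleftrightarrow> multigraph G \<and> verts G \<noteq> {} \<and> (\<forall>e \<in> edges G. card (ends G e) = 2) \<and>
     card (edges G) + 2 = 2 * card (verts G) \<and>
     (\<forall>S. S \<subset> verts G \<and> 2 \<le> card S \<longrightarrow> card {e \<in> edges G. ends G e \<subseteq> S} + 3 \<le> 2 * card S)"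

lemma subgraph_simps [simp]:
  "verts (subgraph G F) = \<Union> (ends G ` F)" "edges (subgraph G F) = F"
  "ends (subgraph G F) = ends G"
  by (simp_all add: subgraph_def)

lemma multigraph_subgraph: "multigraph G \<Longrightarrow> F \<subseteq> edges G \<Longrightarrow> multigraph (subgraph G F)"
  unfolding multigraph_def by (auto dest: finite_subset simp: subset_iff intro: finite_subset)

lemma loop_number_subgraph_empty: "loop_number (subgraph G {}) = 0"
proof -
  have "cycle_space (subgraph G {}) = {0}"
    by (auto simp: cycle_space_altdef edge_chains_def boundary_def)
  with card_cycle_space[of "subgraph G {}"] show ?thesis by (cases "loop_number (subgraph G {})") auto
qed

text \<open>No edge of \<open>F\<close> leaves \<open>S\<close>, so a cycle in \<open>F\<close>
  restricts to cycles in \<open>F1\<close> and \<open>F - F1\<close> and is determined by the two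
  restrictions.\<close>

lemma loop_number_split:
  fixes G :: "('v, 'e) mgraph"
  assumes "finite F" and split: "\<And>e. e \<in> F \<Longrightarrow> ends G e \<subseteq> S \<or> ends G e \<inter> S = {}"
    and F1: "F1 = {e \<in> F. ends G e \<subseteq> S}"
  shows "loop_number (subgraph G F) \<le> loop_number (subgraph G F1) + loop_number (subgraph G (F - F1))"
proof -
  have fin: "finite F1" "finite (F - F1)" using assms by auto
  define res where "res f A e = (if e \<in> A then f e else 0)" for f :: "'e \<Rightarrow> bit" and A e
  have res: "res f A \<in> cycle_space (subgraph G A)"
    if f: "f \<in> cycle_space (subgraph G F)" and A: "A = F1 \<or> A = F - F1" for f A
  proof -
    have AF: "A \<subseteq> F" using A F1 by auto
    have "boundary (subgraph G A) (res f A) v = boundary (subgraph G F) f v"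
      if "v \<in> \<Union> (ends G ` A)" for v
    proof -
      from that obtain e where e: "e \<in> A" "v \<in> ends G e" by auto
      \<comment> \<open>All edges of \<open>F\<close> at a vertex touched by \<open>A\<close> lie in
        \<open>A\<close>, so restricting does not change the boundary there.\<close>
      have "e' \<in> A" if "e' \<in> F" "v \<in> ends G e'" for e'
        using e that A split[of e'] split[of e] AF unfolding F1 by blast
      then have "{e' \<in> A. v \<in> ends G e' \<and> ends G e' \<noteq> {v}} = {e' \<in> F. v \<in> ends G e' \<and> ends G e' \<noteq> {v}}"
        using AF by blast
      then show ?thesis unfolding boundary_def subgraph_simps
        by (intro sum.cong) (auto simp: res_def)
    qed
    moreover have "boundary (subgraph G F) f v = 0" if "v \<in> \<Union> (ends G ` A)" for v
      using f that AF by (auto simp: cycle_space_altdef)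
    ultimately show ?thesis
      by (auto simp: cycle_space_altdef edge_chains_def) (auto simp: res_def)
  qed
  let ?K = "\<lambda>A. cycle_space (subgraph G A)"
  have "inj_on (\<lambda>f. (res f F1, res f (F - F1))) (?K F)"
  proof (rule inj_onI, rule ext)
    fix f g e assume f: "f \<in> ?K F" "g \<in> ?K F" and eq: "(res f F1, res f (F - F1)) = (res g F1, res g (F - F1))"
    have "res f F1 e = res g F1 e" "res f (F - F1) e = res g (F - F1) e" using eq by simp_all
    moreover have "f e = 0 \<and> g e = 0" if "e \<notin> F"
      using f that by (simp add: cycle_space_altdef edge_chains_def)
    ultimately show "f e = g e"
      unfolding res_def by (cases "e \<in> F"; cases "e \<in> F1") (simp_all split: if_splits)
  qed
  moreover have "(\<lambda>f. (res f F1, res f (F - F1))) ` ?K F \<subseteq> ?K F1 \<times> ?K (F - F1)"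
    using res by blast
  moreover have "finite (?K F1 \<times> ?K (F - F1))"
    using fin card_cycle_space[of "subgraph G F1"] card_cycle_space[of "subgraph G (F - F1)"] by simp
  ultimately have "card (?K F) \<le> card (?K F1 \<times> ?K (F - F1))" by (rule card_inj_on_le)
  then have "(2::nat) ^ loop_number (subgraph G F) \<le>
      2 ^ (loop_number (subgraph G F1) + loop_number (subgraph G (F - F1)))"
    using fin assms(1) card_cycle_space[of "subgraph G F1"] card_cycle_space[of "subgraph G (F - F1)"]
      card_cycle_space[of "subgraph G F"]
    by (simp add: card_cartesian_product power_add)
  then show ?thesis by simp
qed

text \<open>The induction splits off the component \<open>F1\<close> of one edge, with vertex set
  \<open>S\<close>. Connectedness gives h <= |F1| - |S| + 1, and |F1| <= 2|S| - 3 turns this into 2h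
  < |F1|. The remaining edges are covered by the induction hypothesis.\<close>

lemma tight_imp_loop_number_subgraph:
  assumes "tight G" "F \<subset> edges G" "F \<noteq> {}"
  shows "2 * loop_number (subgraph G F) < card F"
  using assms(2,3)
proof (induction "card F" arbitrary: F rule: less_induct)
  case less
  have G: "multigraph G" "card (edges G) + 2 = 2 * card (verts G)"
    "\<And>e. e \<in> edges G \<Longrightarrow> card (ends G e) = 2"
    "\<And>S. S \<subset> verts G \<Longrightarrow> 2 \<le> card S \<Longrightarrow> card {e \<in> edges G. ends G e \<subseteq> S} + 3 \<le> 2 * card S"
    using assms(1) by (auto simp: tight_def)
  have fin: "finite (verts G)" "finite (edges G)" and ends: "\<And>e. e \<in> edges G \<Longrightarrow> ends G e \<subseteq> verts G"
    using G by (auto simp: multigraph_def)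
  have finF: "finite F" using fin less.prems by (auto dest: finite_subset)
  obtain e0 where e0: "e0 \<in> F" using less.prems by auto
  then have c0: "card (ends G e0) = 2" using G less.prems by auto
  then obtain r where r: "r \<in> ends G e0" by (metis all_not_in_conv card.empty zero_neq_numeral)
  define R where "R = {(a, b). \<exists>e \<in> F. a \<in> ends G e \<and> b \<in> ends G e}"
  define S where "S = R\<^sup>* `` {r}"
  have step: "b \<in> S" if "a \<in> S" "e \<in> F" "a \<in> ends G e" "b \<in> ends G e" for a b e
    using that unfolding S_def R_def by (auto intro: rtrancl_into_rtrancl)
  have split: "ends G e \<subseteq> S \<or> ends G e \<inter> S = {}" if "e \<in> F" for e
    using step that by blast
  have "r \<in> S" by (simp add: S_def)
  with r e0 have e0S: "ends G e0 \<subseteq> S" using step by blast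
  define F1 where "F1 = {e \<in> F. ends G e \<subseteq> S}"
  have SV: "v \<in> \<Union> (ends G ` F1)" if "(r, v) \<in> R\<^sup>*" for v
    using that
  proof (cases rule: rtranclE)
    case base
    then show ?thesis using r e0 e0S by (auto simp: F1_def)
  next
    case (step y)
    then obtain e where e: "e \<in> F" "y \<in> ends G e" "v \<in> ends G e" by (auto simp: R_def)
    moreover have "y \<in> S" using step by (simp add: S_def)
    ultimately show ?thesis using split[of e] by (auto simp: F1_def)
  qed
  then have VF1: "\<Union> (ends G ` F1) = S" by (auto simp: F1_def S_def)
  have S: "S \<subseteq> verts G" using VF1 ends less.prems by (auto simp: F1_def)
  have cS: "2 \<le> card S"
    using card_mono[OF finite_subset[OF S fin(1)] e0S] c0 by simp
  have "F1 \<subseteq> F" "e0 \<in> F1" using e0 e0S by (auto simp: F1_def)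
  have "loop_number (subgraph G F1) + card (verts (subgraph G F1)) \<le> card (edges (subgraph G F1)) + 1"
  proof (rule loop_number_le)
    show "multigraph (subgraph G F1)"
      using multigraph_subgraph[OF G(1)] \<open>F1 \<subseteq> F\<close> less.prems by auto
    show "r \<in> verts (subgraph G F1)" using SV by auto
  next
    fix T assume T: "T \<subseteq> verts (subgraph G F1)" "r \<in> T"
      "\<And>e. e \<in> edges (subgraph G F1) \<Longrightarrow> ends (subgraph G F1) e \<inter> T \<noteq> {} \<Longrightarrow> ends (subgraph G F1) e \<subseteq> T"
    have "v \<in> T" if "(r, v) \<in> R\<^sup>*" for v
      using that
    proof (induction rule: rtrancl_induct)
      case (step y z)
      then obtain e where e: "e \<in> F" "y \<in> ends G e" "z \<in> ends G e" by (auto simp: R_def)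
      moreover have "y \<in> S" using step by (simp add: S_def)
      ultimately have "e \<in> F1" using split[of e] by (auto simp: F1_def)
      then show ?case using T(3)[of e] e step by auto
    qed (use T in simp)
    then have "S \<subseteq> T" by (auto simp: S_def)
    with T(1) VF1 show "T = verts (subgraph G F1)" by auto
  qed
  then have h1: "loop_number (subgraph G F1) + card S \<le> card F1 + 1" by (simp add: VF1)
  \<comment> \<open>If \<open>S\<close> is the whole vertex set, tightness only gives 2|S| - 2; the
    missing edge comes from \<open>F\<close> being a proper subset.\<close>
  have "card F1 + 3 \<le> 2 * card S"
  proof (cases "S = verts G")
    case True
    have "card F1 < card (edges G)"
      using \<open>F1 \<subseteq> F\<close> less.prems fin by (intro psubset_card_mono) auto
    then show ?thesis using True G(2) by simp
  next
    case False
    have "card F1 \<le> card {e \<in> edges G. ends G e \<subseteq> S}"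
      using less.prems fin by (intro card_mono) (auto simp: F1_def)
    then show ?thesis using G(4)[of S] False S cS by force
  qed
  then have h1': "2 * loop_number (subgraph G F1) < card F1" using h1 by linarith
  have h: "loop_number (subgraph G F) \<le> loop_number (subgraph G F1) + loop_number (subgraph G (F - F1))"
    using loop_number_split[OF finF split F1_def] .
  have cF: "card F = card F1 + card (F - F1)"
    using finF \<open>F1 \<subseteq> F\<close> by (metis card_Diff_subset card_mono finite_subset le_add_diff_inverse)
  have h2: "2 * loop_number (subgraph G (F - F1)) \<le> card (F - F1)"
  proof (cases "F - F1 = {}")
    case True
    then show ?thesis by (simp only: loop_number_subgraph_empty)
  next
    case False
    have "card (F - F1) < card F"
      using e0 \<open>e0 \<in> F1\<close> finF by (intro psubset_card_mono) auto
    then show ?thesis using less.hyps[of "F - F1"] False less.prems by (auto intro: less_imp_le)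
  qed
  show ?case using h h1' h2 cF by linarith
qed

text \<open>Tight graphs are connected: if no edge joined \<open>T\<close> to its complement, the
  sparsity bounds on the two sides would leave at most 2|V| - 4 edges.\<close>

lemma tight_imp_loop_number:
  assumes "tight G"
  shows "loop_number G + 1 = card (verts G)"
proof -
  have G: "multigraph G" "card (edges G) + 2 = 2 * card (verts G)" "verts G \<noteq> {}"
    "\<And>e. e \<in> edges G \<Longrightarrow> card (ends G e) = 2"
    "\<And>S. S \<subset> verts G \<Longrightarrow> 2 \<le> card S \<Longrightarrow> card {e \<in> edges G. ends G e \<subseteq> S} + 3 \<le> 2 * card S"
    using assms by (auto simp: tight_def)
  have fin: "finite (verts G)" "finite (edges G)" and ends: "\<And>e. e \<in> edges G \<Longrightarrow> ends G e \<subseteq> verts G"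
    using G by (auto simp: multigraph_def)
  \<comment> \<open>The weaker constant 2 includes singletons, which span no edge because every edge
    has two ends.\<close>
  have sparse: "card {e \<in> edges G. ends G e \<subseteq> S} + 2 \<le> 2 * card S" if "S \<subset> verts G" "S \<noteq> {}" for S
  proof (cases "2 \<le> card S")
    case False
    have "finite S" using that fin by (auto dest: finite_subset)
    have "card S > 0" using that \<open>finite S\<close> by (simp add: card_gt_0_iff)
    with False have "card S = 1" by simp
    have "\<not> ends G e \<subseteq> S" if "e \<in> edges G" for e
      using card_mono[OF \<open>finite S\<close>, of "ends G e"] G(4)[OF that] \<open>card S = 1\<close> by auto
    then have "{e \<in> edges G. ends G e \<subseteq> S} = {}" by auto
    then show ?thesis using \<open>card S = 1\<close> by (simp only: card.empty)
  qed (use G(5)[of S] that in simp)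
  obtain r where r: "r \<in> verts G" using G by auto
  have "loop_number G + card (verts G) \<le> card (edges G) + 1"
  proof (rule loop_number_le[OF G(1) r], rule ccontr)
    fix T assume T: "T \<subseteq> verts G" "r \<in> T"
      "\<And>e. e \<in> edges G \<Longrightarrow> ends G e \<inter> T \<noteq> {} \<Longrightarrow> ends G e \<subseteq> T" "T \<noteq> verts G"
    let ?U = "verts G - T"
    have proper: "T \<subset> verts G" "T \<noteq> {}" "?U \<subset> verts G" "?U \<noteq> {}"
      using T r by auto
    have "edges G \<subseteq> {e \<in> edges G. ends G e \<subseteq> T} \<union> {e \<in> edges G. ends G e \<subseteq> ?U}"
      using T(3) ends by blast
    then have "card (edges G) \<le> card ({e \<in> edges G. ends G e \<subseteq> T} \<union> {e \<in> edges G. ends G e \<subseteq> ?U})"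
      using fin by (intro card_mono) auto
    also have "\<dots> \<le> card {e \<in> edges G. ends G e \<subseteq> T} + card {e \<in> edges G. ends G e \<subseteq> ?U}"
      by (rule card_Un_le)
    finally have "card (edges G) + 4 \<le> 2 * card T + 2 * card ?U"
      using sparse[of T] sparse[of ?U] proper by auto
    also have "\<dots> = 2 * card (verts G)"
      using T(1) fin by (metis card_Diff_subset card_mono distrib_left finite_subset le_add_diff_inverse)
    finally show False using G(2) by simp
  qed
  with loop_number_ge[OF G(1,3)] G(2) show ?thesis by linarith
qed

lemma tight_imp_primitive_divergent:
  assumes "tight G"
  shows "primitive_divergent G"
  unfolding primitive_divergent_def
  using tight_imp_loop_number_subgraph[OF assms] tight_imp_loop_number[OF assms] assms
  by (auto simp: tight_def)

section \<open>Isomorphisms and minors\<close>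

text \<open>The hypothesis on \<open>G\<close> keeps the ends of edges inside the vertex set, where
  the vertex bijection can be inverted.\<close>

lemma iso_sym:
  assumes "multigraph G" "iso G H"
  shows "iso H G"
proof -
  obtain \<phi> \<psi> where \<phi>: "bij_betw \<phi> (verts G) (verts H)" and \<psi>: "bij_betw \<psi> (edges G) (edges H)"
    and ends: "\<And>e. e \<in> edges G \<Longrightarrow> ends H (\<psi> e) = \<phi> ` ends G e"
    using assms by (auto simp: iso_def)
  have "ends G (inv_into (edges G) \<psi> f) = inv_into (verts G) \<phi> ` ends H f" if "f \<in> edges H" for f
  proof -
    have e: "inv_into (edges G) \<psi> f \<in> edges G" "\<psi> (inv_into (edges G) \<psi> f) = f"
      using \<psi> that by (auto simp: bij_betw_def inv_into_into f_inv_into_f)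
    have "ends G (inv_into (edges G) \<psi> f) \<subseteq> verts G"
      using assms e by (auto simp: multigraph_def)
    then show ?thesis using \<phi> ends[OF e(1)] e(2)
      by (metis bij_betw_def inv_into_image_cancel)
  qed
  then show ?thesis unfolding iso_def
    using bij_betw_inv_into[OF \<phi>] bij_betw_inv_into[OF \<psi>] by blast
qed

lemma iso_trans:
  assumes "iso G H" "iso H K"
  shows "iso G K"
proof -
  obtain \<phi> \<psi> where 1: "bij_betw \<phi> (verts G) (verts H)" "bij_betw \<psi> (edges G) (edges H)"
    "\<And>e. e \<in> edges G \<Longrightarrow> ends H (\<psi> e) = \<phi> ` ends G e"
    using assms by (auto simp: iso_def)
  obtain \<phi>' \<psi>' where 2: "bij_betw \<phi>' (verts H) (verts K)" "bij_betw \<psi>' (edges H) (edges K)"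
    "\<And>e. e \<in> edges H \<Longrightarrow> ends K (\<psi>' e) = \<phi>' ` ends H e"
    using assms by (auto simp: iso_def)
  have "ends K ((\<psi>' \<circ> \<psi>) e) = (\<phi>' \<circ> \<phi>) ` ends G e" if "e \<in> edges G" for e
    using that 1 2 by (auto simp: bij_betw_apply image_comp)
  then show ?thesis unfolding iso_def
    using bij_betw_trans[OF 1(1) 2(1)] bij_betw_trans[OF 1(2) 2(2)] by blast
qed

lemma iso_multigraph:
  assumes "iso G H" "multigraph G"
  shows "multigraph H"
proof -
  obtain \<phi> \<psi> where \<phi>: "bij_betw \<phi> (verts G) (verts H)" and \<psi>: "bij_betw \<psi> (edges G) (edges H)"
    and ends: "\<And>e. e \<in> edges G \<Longrightarrow> ends H (\<psi> e) = \<phi> ` ends G e"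
    using assms by (auto simp: iso_def)
  have "ends H f \<subseteq> verts H \<and> card (ends H f) \<in> {1, 2}" if "f \<in> edges H" for f
  proof -
    have "f \<in> \<psi> ` edges G" using that bij_betw_imp_surj_on[OF \<psi>] by simp
    then obtain e where e: "e \<in> edges G" "f = \<psi> e" by auto
    then have *: "ends G e \<subseteq> verts G" "card (ends G e) \<in> {1, 2}" using assms(2) by (auto simp: multigraph_def)
    have "card (\<phi> ` ends G e) = card (ends G e)"
      using \<phi> * by (intro card_image) (auto simp: bij_betw_def intro: inj_on_subset)
    moreover have "\<phi> ` ends G e \<subseteq> verts H" using * \<phi> by (auto simp: bij_betw_def)
    ultimately show ?thesis using ends[OF e(1)] e(2) * by simp
  qed
  then show ?thesis
    using assms(2) bij_betw_finite[OF \<phi>] bij_betw_finite[OF \<psi>] by (auto simp: multigraph_def)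
qed

lemma iso_tight:
  assumes "iso G H" "tight G"
  shows "tight H"
proof -
  obtain \<phi> \<psi> where \<phi>: "bij_betw \<phi> (verts G) (verts H)" and \<psi>: "bij_betw \<psi> (edges G) (edges H)"
    and ends: "\<And>e. e \<in> edges G \<Longrightarrow> ends H (\<psi> e) = \<phi> ` ends G e"
    using assms by (auto simp: iso_def)
  have G: "multigraph G" "verts G \<noteq> {}" "\<And>e. e \<in> edges G \<Longrightarrow> card (ends G e) = 2"
    "card (edges G) + 2 = 2 * card (verts G)"
    "\<And>S. S \<subset> verts G \<Longrightarrow> 2 \<le> card S \<Longrightarrow> card {e \<in> edges G. ends G e \<subseteq> S} + 3 \<le> 2 * card S"
    using assms(2) by (auto simp: tight_def)
  have sub: "ends G e \<subseteq> verts G" if "e \<in> edges G" for e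
    using G that by (auto simp: multigraph_def)
  have "card (ends H f) = 2" if "f \<in> edges H" for f
  proof -
    have "f \<in> \<psi> ` edges G" using that bij_betw_imp_surj_on[OF \<psi>] by simp
    then obtain e where e: "e \<in> edges G" "f = \<psi> e" by auto
    have "card (\<phi> ` ends G e) = card (ends G e)"
      using \<phi> sub[OF e(1)] by (intro card_image) (auto simp: bij_betw_def intro: inj_on_subset)
    then show ?thesis using ends[OF e(1)] e(2) G(3)[OF e(1)] by simp
  qed
  moreover have "card {f \<in> edges H. ends H f \<subseteq> S} + 3 \<le> 2 * card S"
    if S: "S \<subset> verts H" "2 \<le> card S" for S
  proof -
    define T where "T = {v \<in> verts G. \<phi> v \<in> S}"
    have inj: "inj_on \<phi> (verts G)" and im: "\<phi> ` verts G = verts H"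
      using \<phi> by (simp_all add: bij_betw_def)
    have TG: "T \<subseteq> verts G" by (auto simp: T_def)
    have T: "\<phi> ` T = S"
    proof
      show "\<phi> ` T \<subseteq> S" by (auto simp: T_def)
      have "S \<subseteq> \<phi> ` verts G" using S im by auto
      then show "S \<subseteq> \<phi> ` T" by (force simp: T_def)
    qed
    have cT: "card T = card S" using T card_image[OF inj_on_subset[OF inj TG]] by simp
    have "T \<noteq> verts G" using T S(1) im by auto
    with TG have "T \<subset> verts G" by simp
    have "{f \<in> edges H. ends H f \<subseteq> S} = \<psi> ` {e \<in> edges G. ends G e \<subseteq> T}"
    proof -
      have "ends H (\<psi> e) \<subseteq> S \<longleftrightarrow> ends G e \<subseteq> T" if "e \<in> edges G" for e
        using ends[OF that] sub[OF that] by (auto simp: T_def)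
      then show ?thesis unfolding bij_betw_imp_surj_on[OF \<psi>, symmetric] by auto
    qed
    then have "card {f \<in> edges H. ends H f \<subseteq> S} \<le> card {e \<in> edges G. ends G e \<subseteq> T}"
      using G(1) by (auto simp: multigraph_def intro!: card_image_le)
    with G(5)[OF \<open>T \<subset> verts G\<close>] cT S show ?thesis by simp
  qed
  moreover have "verts H \<noteq> {}" using \<phi> G(2) by (auto simp: bij_betw_def)
  ultimately show ?thesis
    unfolding tight_def using iso_multigraph[OF assms(1) G(1)] G(4)
      bij_betw_same_card[OF \<phi>] bij_betw_same_card[OF \<psi>] by auto
qed

lemma iso_in_phi4:
  assumes "iso G H" "multigraph G" "in_phi4 G"
  shows "in_phi4 H"
  unfolding in_phi4_def
proof
  obtain \<phi> \<psi> where \<phi>: "bij_betw \<phi> (verts G) (verts H)" and \<psi>: "bij_betw \<psi> (edges G) (edges H)"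
    and ends: "\<And>e. e \<in> edges G \<Longrightarrow> ends H (\<psi> e) = \<phi> ` ends G e"
    using assms by (auto simp: iso_def)
  fix w assume "w \<in> verts H"
  then obtain v where v: "v \<in> verts G" "w = \<phi> v" using \<phi> by (auto simp: bij_betw_def)
  have inj: "inj_on \<phi> (verts G)" using \<phi> by (simp add: bij_betw_def)
  have sub: "ends G e \<subseteq> verts G" if "e \<in> edges G" for e
    using assms(2) that by (auto simp: multigraph_def)
  have mem: "w \<in> ends H (\<psi> e) \<longleftrightarrow> v \<in> ends G e" if "e \<in> edges G" for e
    using ends[OF that] sub[OF that] v inj by (auto dest: inj_onD)
  have sing: "ends H (\<psi> e) = {w} \<longleftrightarrow> ends G e = {v}" if "e \<in> edges G" for e
    using ends[OF that] sub[OF that] v inj inj_on_image_eq_iff[of \<phi> "verts G" "ends G e" "{v}"] by auto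
  have "{f \<in> edges H. w \<in> ends H f} = \<psi> ` {e \<in> edges G. v \<in> ends G e}"
    "{f \<in> edges H. ends H f = {w}} = \<psi> ` {e \<in> edges G. ends G e = {v}}"
    unfolding bij_betw_imp_surj_on[OF \<psi>, symmetric] using mem sing by auto
  moreover have "card (\<psi> ` {e \<in> edges G. v \<in> ends G e}) \<le> card {e \<in> edges G. v \<in> ends G e}"
    "card (\<psi> ` {e \<in> edges G. ends G e = {v}}) \<le> card {e \<in> edges G. ends G e = {v}}"
    using assms(2) by (auto simp: multigraph_def intro!: card_image_le)
  moreover have "degree G v \<le> 4" using assms(3) v by (simp add: in_phi4_def)
  ultimately show "degree H w \<le> 4" by (simp add: degree_def)
qed

lemma iso_planar:
  assumes "iso G H" "multigraph G" "planar G"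
  shows "planar H"
proof -
  obtain \<phi> \<psi> where \<phi>: "bij_betw \<phi> (verts H) (verts G)" and \<psi>: "bij_betw \<psi> (edges H) (edges G)"
    and ends: "\<And>e. e \<in> edges H \<Longrightarrow> ends G (\<psi> e) = \<phi> ` ends H e"
    using iso_sym[OF assms(2,1)] by (auto simp: iso_def)
  have sub: "ends H e \<subseteq> verts H" if "e \<in> edges H" for e
    using iso_multigraph[OF assms(1,2)] that by (auto simp: multigraph_def)
  obtain p :: "'a \<Rightarrow> complex" and \<gamma> where p: "inj_on p (verts G)"
    and edge: "\<And>e. e \<in> edges G \<Longrightarrow> simple_path (\<gamma> e) \<and>
        {pathstart (\<gamma> e), pathfinish (\<gamma> e)} = p ` ends G e \<and>
        path_image (\<gamma> e) \<inter> p ` verts G = p ` ends G e"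
    and two: "\<And>e f. e \<in> edges G \<Longrightarrow> f \<in> edges G \<Longrightarrow> e \<noteq> f \<Longrightarrow>
        path_image (\<gamma> e) \<inter> path_image (\<gamma> f) = p ` (ends G e \<inter> ends G f)"
    using assms(3) unfolding planar_def by metis
  have inj: "inj_on \<phi> (verts H)" and im: "\<phi> ` verts H = verts G"
    and \<psi>e: "\<And>e. e \<in> edges H \<Longrightarrow> \<psi> e \<in> edges G"
    using \<phi> \<psi> by (auto simp: bij_betw_def)
  show ?thesis unfolding planar_def
  proof (intro exI[of _ "p \<circ> \<phi>"] exI[of _ "\<gamma> \<circ> \<psi>"] conjI ballI impI)
    show "inj_on (p \<circ> \<phi>) (verts H)" using inj im p by (auto intro: comp_inj_on)
  next
    fix e assume e: "e \<in> edges H"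
    show "simple_path ((\<gamma> \<circ> \<psi>) e)"
      "{pathstart ((\<gamma> \<circ> \<psi>) e), pathfinish ((\<gamma> \<circ> \<psi>) e)} = (p \<circ> \<phi>) ` ends H e"
      "path_image ((\<gamma> \<circ> \<psi>) e) \<inter> (p \<circ> \<phi>) ` verts H = (p \<circ> \<phi>) ` ends H e"
      using edge[OF \<psi>e[OF e]] im by (simp_all add: ends[OF e] flip: image_image)
  next
    fix e f assume e: "e \<in> edges H" and f: "f \<in> edges H" and "e \<noteq> f"
    then have "\<psi> e \<noteq> \<psi> f" using \<psi> by (auto simp: bij_betw_def dest: inj_onD)
    have "\<phi> ` (ends H e \<inter> ends H f) = \<phi> ` ends H e \<inter> \<phi> ` ends H f"
      using inj sub[OF e] sub[OF f] by (rule inj_on_image_Int)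
    then show "path_image ((\<gamma> \<circ> \<psi>) e) \<inter> path_image ((\<gamma> \<circ> \<psi>) f) = (p \<circ> \<phi>) ` (ends H e \<inter> ends H f)"
      using two[OF \<psi>e[OF e] \<psi>e[OF f] \<open>\<psi> e \<noteq> \<psi> f\<close>]
      by (simp add: ends[OF e] ends[OF f] flip: image_image)
  qed
qed

text \<open>The theorem asks for natural numbers as vertices and edges, whereas the construction
  uses pairs and labelled links.\<close>

lemma exists_iso_nat:
  assumes "multigraph G"
  obtains H :: "(nat, nat) mgraph" where "iso G H"
proof -
  have "finite (verts G)" "finite (edges G)" using assms by (auto simp: multigraph_def)
  then obtain \<phi> \<psi> :: "_ \<Rightarrow> nat" where inj: "inj_on \<phi> (verts G)" "inj_on \<psi> (edges G)"
    using finite_imp_inj_to_nat_seg by metis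
  define H where "H = \<lparr>verts = \<phi> ` verts G, edges = \<psi> ` edges G,
    ends = (\<lambda>k. \<phi> ` ends G (inv_into (edges G) \<psi> k))\<rparr>"
  have "iso G H"
    unfolding iso_def H_def using inj
    by (intro exI[of _ \<phi>] exI[of _ \<psi>]) (auto simp: bij_betw_def)
  then show thesis by (rule that)
qed

lemma minor_delete_edges:
  assumes "finite F" "F \<subseteq> edges G"
  shows "minor G (G\<lparr>edges := edges G - F\<rparr>)"
  using assms
proof (induction F rule: finite_induct)
  case empty
  then show ?case using minor.refl[of G] by simp
next
  case (insert e F)
  then have "minor G (delete_edge (G\<lparr>edges := edges G - F\<rparr>) e)"
    by (intro minor.delete) auto
  moreover have "edges G - F - {e} = edges G - insert e F" by auto
  ultimately show ?case by (simp add: delete_edge_def)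
qed

text \<open>The minor is reached by deletions alone. The edges to be removed are carried along the
  edge bijection, and what remains of \<open>H\<close> is isomorphic to what remains of
  \<open>G\<close>.\<close>

lemma has_minor_iso:
  assumes "iso G H" "multigraph G" "F \<subseteq> edges G" "iso (G\<lparr>edges := edges G - F\<rparr>) K"
  shows "has_minor H K"
proof -
  obtain \<phi> \<psi> where \<phi>: "bij_betw \<phi> (verts G) (verts H)" and \<psi>: "bij_betw \<psi> (edges G) (edges H)"
    and ends: "\<And>e. e \<in> edges G \<Longrightarrow> ends H (\<psi> e) = \<phi> ` ends G e"
    using assms by (auto simp: iso_def)
  have fin: "finite F" "finite (edges H)"
    using assms iso_multigraph[OF assms(1,2)] by (auto simp: multigraph_def dest: finite_subset)
  let ?H = "H\<lparr>edges := edges H - \<psi> ` F\<rparr>"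
  have "bij_betw \<psi> (edges G - F) (edges H - \<psi> ` F)"
    unfolding bij_betw_def
    using bij_betw_imp_inj_on[OF \<psi>] bij_betw_imp_surj_on[OF \<psi>] assms(3)
      inj_on_image_set_diff[of \<psi> "edges G" "edges G" F]
    by (intro conjI inj_on_diff) simp_all
  with \<phi> ends have "iso (G\<lparr>edges := edges G - F\<rparr>) ?H"
    unfolding iso_def by (intro exI[of _ \<phi>] exI[of _ \<psi>]) auto
  moreover have "multigraph (G\<lparr>edges := edges G - F\<rparr>)"
    using assms(2) by (auto simp: multigraph_def)
  ultimately have "iso ?H K" using iso_sym iso_trans assms(4) by blast
  moreover have "minor H ?H"
    using fin \<psi> assms(3) by (intro minor_delete_edges) (auto simp: bij_betw_def)
  ultimately show ?thesis unfolding has_minor_def by blast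
qed

section \<open>The grid with chords\<close>

datatype link = Horiz nat nat | Vert nat nat | Chord nat

text \<open>Edges are labels, so chord ends can be chosen freely and parallel edges stay distinct.
  The grid has 2n(n - 1) edges, hence \<open>2 * n - 2\<close> chords complete it to the edge count
  of a tight graph.\<close>

definition augmented_grid ::
    "nat \<Rightarrow> (nat \<Rightarrow> nat \<times> nat) \<Rightarrow> (nat \<Rightarrow> nat \<times> nat) \<Rightarrow> (nat \<times> nat, link) mgraph" where
  "augmented_grid n a b = \<lparr>verts = {..<n} \<times> {..<n},
     edges = {Horiz i j | i j. i < n \<and> Suc j < n} \<union> {Vert i j | i j. Suc i < n \<and> j < n} \<union>
             Chord ` {..<2 * n - 2},
     ends = (\<lambda>e. case e of Horiz i j \<Rightarrow> {(i, j), (i, Suc j)} | Vert i j \<Rightarrow> {(i, j), (Suc i, j)}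
                         | Chord k \<Rightarrow> {a k, b k})\<rparr>"

definition valid_chords :: "nat \<Rightarrow> (nat \<Rightarrow> nat \<times> nat) \<Rightarrow> (nat \<Rightarrow> nat \<times> nat) \<Rightarrow> bool" where
  "valid_chords n a b \<longleftrightarrow>
     (\<forall>k < 2 * n - 2. a k \<in> {..<n} \<times> {..<n} \<and> b k \<in> {..<n} \<times> {..<n} \<and> a k \<noteq> b k)"

lemma verts_augmented_grid [simp]: "verts (augmented_grid n a b) = {..<n} \<times> {..<n}"
  by (simp add: augmented_grid_def)

lemma edges_augmented_grid_iff [simp]:
  "Horiz i j \<in> edges (augmented_grid n a b) \<longleftrightarrow> i < n \<and> Suc j < n"
  "Vert i j \<in> edges (augmented_grid n a b) \<longleftrightarrow> Suc i < n \<and> j < n"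
  "Chord k \<in> edges (augmented_grid n a b) \<longleftrightarrow> k < 2 * n - 2"
  by (auto simp: augmented_grid_def)

lemma ends_augmented_grid [simp]:
  "ends (augmented_grid n a b) (Horiz i j) = {(i, j), (i, Suc j)}"
  "ends (augmented_grid n a b) (Vert i j) = {(i, j), (Suc i, j)}"
  "ends (augmented_grid n a b) (Chord k) = {a k, b k}"
  by (simp_all add: augmented_grid_def)

lemma edges_augmented_grid:
  "edges (augmented_grid n a b) = (\<lambda>(i, j). Horiz i j) ` ({..<n} \<times> {..<n - 1}) \<union>
     (\<lambda>(i, j). Vert i j) ` ({..<n - 1} \<times> {..<n}) \<union> Chord ` {..<2 * n - 2}"
  by (auto simp: augmented_grid_def)

lemma finite_edges_augmented_grid [simp]: "finite (edges (augmented_grid n a b))"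
  by (auto simp: edges_augmented_grid)

lemma card_edges_augmented_grid:
  assumes "n \<ge> 1"
  shows "card (edges (augmented_grid n a b)) + 2 = 2 * (n * n)"
proof -
  obtain m where m: "n = Suc m" using assms by (cases n) auto
  have "card (edges (augmented_grid n a b)) =
      card ((\<lambda>(i, j). Horiz i j) ` ({..<n} \<times> {..<n - 1})) +
      card ((\<lambda>(i, j). Vert i j) ` ({..<n - 1} \<times> {..<n})) + card (Chord ` {..<2 * n - 2})"
    unfolding edges_augmented_grid
    by (subst card_Un_disjoint, force, force, force, subst card_Un_disjoint) force+
  also have "\<dots> = n * (n - 1) + (n - 1) * n + (2 * n - 2)"
    by (subst (1 2 3) card_image) (auto simp: inj_on_def card_cartesian_product)
  finally show ?thesis by (simp add: m)
qed

lemma ends_augmented_grid_subset: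
  assumes "valid_chords n a b" "e \<in> edges (augmented_grid n a b)"
  shows "ends (augmented_grid n a b) e \<subseteq> {..<n} \<times> {..<n} \<and> card (ends (augmented_grid n a b) e) = 2"
  using assms by (cases e) (auto simp: valid_chords_def)

lemma multigraph_augmented_grid:
  assumes "valid_chords n a b"
  shows "multigraph (augmented_grid n a b)"
  using ends_augmented_grid_subset[OF assms] by (simp add: multigraph_def)

lemma augmented_grid_delete_chords:
  "iso ((augmented_grid n a b)\<lparr>edges := edges (augmented_grid n a b) - Chord ` {..<2 * n - 2}\<rparr>) (grid n)"
proof -
  let ?G = "augmented_grid n a b"
  let ?E = "edges ?G - Chord ` {..<2 * n - 2}"
  have E: "?E = {Horiz i j | i j. i < n \<and> Suc j < n} \<union> {Vert i j | i j. Suc i < n \<and> j < n}"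
    by (auto simp: augmented_grid_def)
  have "inj_on (ends ?G) ?E" unfolding E by (auto simp: inj_on_def doubleton_eq_iff)
  moreover have "ends ?G ` ?E = edges (grid n)"
  proof -
    have "ends ?G ` {Horiz i j | i j. i < n \<and> Suc j < n} = {{(i, j), (i, Suc j)} | i j. i < n \<and> Suc j < n}"
      by (auto intro!: image_eqI[of _ "ends ?G" "Horiz _ _"]) blast+
    moreover have "ends ?G ` {Vert i j | i j. Suc i < n \<and> j < n} = {{(i, j), (Suc i, j)} | i j. Suc i < n \<and> j < n}"
      by (auto intro!: image_eqI[of _ "ends ?G" "Vert _ _"]) blast+
    ultimately show ?thesis unfolding E image_Un grid_def by (simp add: Un_commute)
  qed
  ultimately have "bij_betw (ends ?G) ?E (edges (grid n))" by (simp add: bij_betw_def)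
  then show ?thesis unfolding iso_def
    by (intro exI[of _ id] exI[of _ "ends ?G"]) (simp add: grid_def)
qed

text \<open>The vertex carrying the \<open>k\<close>-th stub of either kind, for \<open>k < 2n\<close>. Each corner carries two stubs:
  \<open>(n - 1, 0)\<close> and \<open>(0, n - 1)\<close> occur twice in one numbering, the other two corners once in each.\<close>

definition left_bottom :: "nat \<Rightarrow> nat \<Rightarrow> nat \<times> nat" where
  "left_bottom n k = (if k < n then (k, 0) else (n - 1, k - n))"

definition top_right :: "nat \<Rightarrow> nat \<Rightarrow> nat \<times> nat" where
  "top_right n k = (if k < n then (0, k) else (k - n, n - 1))"

text \<open>Rows are numbered \<open>0, \<dots>, n - 1\<close> and columns \<open>n, \<dots>, 2n - 1\<close>. The set \<open>A\<close> consists of the lines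
  that meet \<open>S\<close>; the chord \<open>k\<close> leaves from line \<open>k\<close>, so \<open>M\<close> is also the set of lines from which a chord
  inside \<open>S\<close> leaves, and \<open>N\<close> is the set of lines at which such a chord arrives. If the claim fails, at
  most two lines of \<open>A\<close> are missing from each of them. A row in both \<open>M\<close> and \<open>N\<close> has both ends in \<open>S\<close>,
  hence is contained in \<open>S\<close> or belongs to the set \<open>X\<close> of interrupted rows. This yields a full row, from
  which everything else follows.\<close>

lemma chord_count:
  fixes n :: nat
  assumes n: "3 \<le> n" and S: "S \<subset> {..<n} \<times> {..<n}" "2 \<le> card S"
  defines "M \<equiv> {k. k < 2 * n - 2 \<and> left_bottom n k \<in> S \<and> top_right n (k + 2) \<in> S}"
    and "X \<equiv> {i. \<exists>a b c. a < b \<and> b < c \<and> (i, a) \<in> S \<and> (i, b) \<notin> S \<and> (i, c) \<in> S}"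
  shows "card M + 3 \<le> card (fst ` S) + card X + card (snd ` S)"
proof (rule ccontr)
  assume bad: "\<not> ?thesis"
  define R where "R = fst ` S"
  define C where "C = snd ` S"
  define A where "A = R \<union> (+) n ` C"
  \<comment> \<open>Chord \<open>k\<close> arrives at the top of column \<open>k + 2\<close> or at
    the right end of row \<open>k + 2 - n\<close>; the image is the number of that line.\<close>
  define N where "N = (\<lambda>k. if k + 2 < n then n + (k + 2) else k + 2 - n) ` M"
  have finS: "finite S" using S by (auto dest: finite_subset)
  have RI: "i \<in> R" if "(i, j) \<in> S" for i j using that by (force simp: R_def)
  have CI: "j \<in> C" if "(i, j) \<in> S" for i j using that by (force simp: C_def)
  have SD: "i < n" "j < n" if "(i, j) \<in> S" for i j using that S by auto
  have Rn: "i < n" if "i \<in> R" for i using that SD by (auto simp: R_def)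
  have Cn: "j < n" if "j \<in> C" for j using that SD by (auto simp: C_def)
  have fin: "finite R" "finite C" "finite A" using finS by (auto simp: R_def C_def A_def)
  have finX: "finite X"
    by (rule finite_subset[OF _ fin(1)]) (auto simp: X_def intro: RI)
  have XI: "i \<in> X" if "a < b" "b < c" "(i, a) \<in> S" "(i, b) \<notin> S" "(i, c) \<in> S" for a b c i
    using that unfolding X_def by blast
  have finM: "finite M" by (rule finite_subset[of _ "{..<2*n-2}"]) (auto simp: M_def)
  have M1: "(k, 0) \<in> S" if "k \<in> M" "k < n" for k
    using that by (auto simp: M_def left_bottom_def)
  have M2: "(0, k + 2) \<in> S" if "k \<in> M" "k + 2 < n" for k
    using that by (auto simp: M_def top_right_def)
  have M3: "(k + 2 - n, n - 1) \<in> S" if "k \<in> M" "n \<le> k + 2" for k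
    using that by (auto simp: M_def top_right_def)
  have M3': "(i, n - 1) \<in> S" if "n - 2 + i \<in> M" for i
  proof -
    have "n - 2 + i + 2 - n = i" "n \<le> n - 2 + i + 2" using n by simp_all
    with M3[OF that] show ?thesis by metis
  qed
  have M2': "(0, j) \<in> S" if "j - 2 \<in> M" "2 \<le> j" "j < n" for j
    using M2[OF that(1)] that(2,3) by (simp add: le_add_diff_inverse2 del: add_2_eq_Suc')
  have M4: "(n - 1, j) \<in> S" if "n + j \<in> M" for j
    using that by (auto simp: M_def left_bottom_def)
  have M5: "k < 2 * n - 2" if "k \<in> M" for k using that by (simp add: M_def)
  have MA: "M \<subseteq> A"
  proof
    fix k assume k: "k \<in> M"
    show "k \<in> A"
    proof (cases "k < n")
      case True
      then show ?thesis using M1[OF k] RI by (auto simp: A_def)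
    next
      case False
      then obtain j where "k = n + j" by (metis le_Suc_ex linorder_not_le)
      then show ?thesis using M4[of j] k CI by (auto simp: A_def)
    qed
  qed
  have NA: "N \<subseteq> A"
  proof
    fix x assume "x \<in> N"
    then obtain k where "k \<in> M" "x = (if k + 2 < n then n + (k + 2) else k + 2 - n)"
      unfolding N_def by blast
    then show "x \<in> A" using M2[of k] M3[of k] RI CI by (auto simp: A_def)
  qed
  have N1: "n - 2 + i \<in> M" if "i \<in> N" "i < n" for i
  proof -
    from that(1) obtain k where k: "k \<in> M" "i = (if k + 2 < n then n + (k + 2) else k + 2 - n)"
      unfolding N_def by blast
    then have "k = n - 2 + i" using that n by (auto split: if_splits)
    then show ?thesis using k(1) by simp
  qed
  have N2: "2 \<le> j \<and> j - 2 \<in> M" if "n + j \<in> N" "j < n" for j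
  proof -
    from that(1) obtain k where k: "k \<in> M" "n + j = (if k + 2 < n then n + (k + 2) else k + 2 - n)"
      unfolding N_def by blast
    then have "j = k + 2" using M5[of k] by (auto split: if_splits)
    then show ?thesis using k(1) by simp
  qed
  have cA: "card A = card R + card C"
  proof -
    have "card A = card R + card ((+) n ` C)"
      unfolding A_def using fin Rn by (intro card_Un_disjoint) force+
    then show ?thesis by (simp add: card_image)
  qed
  have cN: "card N = card M"
    unfolding N_def by (rule card_image) (auto simp: inj_on_def dest!: M5)
  \<comment> \<open>The negated claim bounds \<open>card A + card X\<close> by
    \<open>card M + 2\<close>, and \<open>M\<close> and \<open>N\<close> are subsets of
    \<open>A\<close> of equal size. This budget of two is exceeded by three missing lines, or by two
    missing lines and an interrupted row.\<close>
  have out: "card (A - M) + card X \<le> 2" "card (A - N) + card X \<le> 2"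
    using bad fin MA NA finM card_mono[OF fin(3) MA] cN cA
    by (simp_all add: card_Diff_subset finite_subset[OF NA] R_def[symmetric] C_def[symmetric])
  have three: False if "x \<in> A - B" "y \<in> A - B" "z \<in> A - B" "x \<noteq> y" "x \<noteq> z" "y \<noteq> z"
      "B = M \<or> B = N" for x y z B
  proof -
    have "card {x, y, z} \<le> card (A - B)" using that fin by (intro card_mono) auto
    with that out show False by auto
  qed
  have two: False if "x \<in> A - B" "y \<in> A - B" "x \<noteq> y" "w \<in> X" "B = M \<or> B = N" for x y w B
  proof -
    have "card {x, y} \<le> card (A - B)" using that fin by (intro card_mono) auto
    moreover have "0 < card X" using that finX by (auto simp: card_gt_0_iff)
    ultimately show False using that out by auto
  qed
  have AR: "i \<in> A" if "i \<in> R" for i using that by (simp add: A_def)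
  have AC: "n + j \<in> A" if "j \<in> C" for j using that by (simp add: A_def)
  \<comment> \<open>Two stubs of each kind carry no chord: the bottoms of the last two columns and
    the tops of the first two. When met, the former columns are missing from \<open>M\<close> and
    the latter from \<open>N\<close>.\<close>
  have top: "n + (n - 1) \<in> A - M" if "n - 1 \<in> C" using AC[OF that] M5 n by fastforce
  have top2: "n + (n - 2) \<in> A - M" if "n - 2 \<in> C" using AC[OF that] M5 n by fastforce
  have low: "n \<in> A - N" if "0 \<in> C" using AC[OF that] N2[of 0] n by auto
  have low1: "n + 1 \<in> A - N" if "1 \<in> C" using AC[OF that] N2[of 1] n by auto
  have "S \<noteq> {}" using S by auto
  then obtain i0 j0 where ij0: "(i0, j0) \<in> S" by auto
  \<comment> \<open>Without chords only one row and one column could be met, so \<open>S\<close>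
    would be a single vertex.\<close>
  have "M \<noteq> {}"
  proof
    assume "M = {}"
    then have "card R + card C \<le> 2" using out cA by simp
    moreover have "0 < card R" "0 < card C" using ij0 RI CI fin by (auto simp: card_gt_0_iff)
    ultimately have "card R = 1" "card C = 1" by auto
    then have "card (R \<times> C) = 1" by (simp add: card_cartesian_product)
    moreover have "card S \<le> card (R \<times> C)"
      using fin RI CI by (intro card_mono) auto
    ultimately show False using S by simp
  qed
  then obtain k0 where k0: "k0 \<in> M" by auto
  \<comment> \<open>If column 0 is avoided, no row lies in \<open>M\<close>, and some chord joins
    \<open>(n - 1, j)\<close> to \<open>(j + 2, n - 1)\<close>. Column \<open>n - 1\<close> and the
    rows \<open>n - 1\<close> and \<open>j + 2\<close> are missing from \<open>M\<close>, which
    forces \<open>j + 2 = n - 1\<close>. The vertex \<open>(n - 1, n - 2)\<close> then either brings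
    in another missing column or interrupts row \<open>n - 1\<close>.\<close>
  have C0: "0 \<in> C"
  proof (rule ccontr)
    assume no: "0 \<notin> C"
    have big: "n \<le> k" if "k \<in> M" for k using M1[OF that] CI no by (meson not_le)
    obtain j where j: "k0 = n + j" using big[OF k0] le_Suc_ex by blast
    have 1: "(n - 1, j) \<in> S" "(j + 2, n - 1) \<in> S" using M4[of j] M3[OF k0] k0 j by auto
    have notM: "i \<in> A - M" if "i \<in> R" for i using big[of i] AR Rn that by fastforce
    have a: "n + (n - 1) \<in> A - M" "n - 1 \<in> A - M" "j + 2 \<in> A - M"
      using top notM RI CI 1 by blast+
    have "j + 2 < n" using SD 1 by blast
    have jn: "j + 2 = n - 1"
      by (rule ccontr, rule three[OF a]) (use \<open>j + 2 < n\<close> n in auto)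
    show False
    proof (cases "(n - 1, n - 2) \<in> S")
      case True
      then show False by (intro three[OF a(1,2) top2]) (use CI n in auto)
    next
      case False
      then have "n - 1 \<in> X" using XI[of j "n - 2" "n - 1" "n - 1"] 1 jn n by auto
      then show False by (rule two[OF a(1,2), rotated]) (use n in auto)
    qed
  qed
  \<comment> \<open>A half-turn of the grid exchanges the two kinds of stubs and permutes the
    chords; this is the previous argument turned around, with \<open>N\<close> in place of
    \<open>M\<close>.\<close>
  have Cn1: "n - 1 \<in> C"
  proof (rule ccontr)
    assume no: "n - 1 \<notin> C"
    have small: "k + 2 < n" if "k \<in> M" for k using M3[OF that] CI no by (meson not_le)
    have 1: "(k0, 0) \<in> S" "(0, k0 + 2) \<in> S" using M1[OF k0] M2[OF k0] small[OF k0] by auto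
    have notN: "i \<in> A - N" if "i \<in> R" for i
      using N1[of i] small AR Rn that by fastforce
    have a: "n \<in> A - N" "0 \<in> A - N" "k0 \<in> A - N"
      using low[OF C0] notN RI 1 by blast+
    have "k0 = 0"
      by (rule ccontr, rule three[OF a]) (use small[OF k0] n in auto)
    show False
    proof (cases "(0, 1) \<in> S")
      case True
      then show False by (intro three[OF a(1,2) low1]) (use CI n in auto)
    next
      case False
      then have "0 \<in> X" using XI[of 0 1 "k0 + 2" 0] 1 \<open>k0 = 0\<close> by simp
      then show False by (rule two[OF a(1,2), rotated]) (use n in auto)
    qed
  qed
  have spanX: "i \<in> X \<or> (\<forall>j<n. (i, j) \<in> S)" if "(i, 0) \<in> S" "(i, n - 1) \<in> S" for i
  proof -
    have "i \<in> X" if j: "j < n" "(i, j) \<notin> S" for j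
    proof -
      have "j \<noteq> 0" "j \<noteq> n - 1" using j \<open>(i, 0) \<in> S\<close> \<open>(i, n - 1) \<in> S\<close> by metis+
      then have "0 < j" "j < n - 1" using j by auto
      then show ?thesis using XI[of 0 j "n - 1" i] j \<open>(i, 0) \<in> S\<close> \<open>(i, n - 1) \<in> S\<close> by simp
    qed
    then show ?thesis by blast
  qed
  have right: "(i, n - 1) \<in> S" if "i \<in> N" "i < n" for i
    using M3'[OF N1[OF that]] .
  have "\<exists>i<n. \<forall>j<n. (i, j) \<in> S"
  proof (rule ccontr)
    assume no: "\<not> (\<exists>i<n. \<forall>j<n. (i, j) \<in> S)"
    have X: "i \<in> X" if "(i, 0) \<in> S" "(i, n - 1) \<in> S" for i
      using spanX[OF that] no SD that by blast
    have X': "i \<in> X" if "i \<in> R" "i \<in> M" "i \<in> N" for i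
      using X M1 right Rn that by blast
    note t = top[OF Cn1] and b = low[OF C0]
    show False
    proof (cases "X = {}")
      case False
      then obtain x where x: "x \<in> X" by auto
      \<comment> \<open>One missing line and one interrupted row exhaust the budget, so every row
        met lies in \<open>M\<close> and \<open>N\<close>, and \<open>x\<close> is the only row met.
        The chord arriving at its right end starts in row \<open>n - 2\<close> if
        \<open>x = 0\<close> and in row \<open>n - 1\<close> otherwise, so \<open>x = n - 1\<close>.
        But chord \<open>n - 1\<close> arrives in row 1, which differs from
        \<open>n - 1\<close>.\<close>
      have RM: "i \<in> M" "i \<in> N" if "i \<in> R" for i
        by (rule ccontr, rule two[OF t _ _ x, of i], use AR that Rn[OF that] n in auto)
          (rule ccontr, rule two[OF b _ _ x, of i], use AR that Rn[OF that] n in auto)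
      have "R \<subseteq> X" using X' RM by auto
      moreover have "\<not> (\<exists>y \<in> X. y \<noteq> x)"
      proof
        assume "\<exists>y \<in> X. y \<noteq> x"
        then obtain y where "y \<in> X" "y \<noteq> x" by auto
        then have "card {x, y} \<le> card X" using x finX by (intro card_mono) auto
        moreover have "0 < card (A - M)" using t fin by (auto simp: card_gt_0_iff)
        ultimately show False using out \<open>y \<noteq> x\<close> by auto
      qed
      ultimately have R: "i = x" if "i \<in> R" for i using that by auto
      have xR: "x \<in> R" using x RI by (auto simp: X_def)
      note xn = Rn[OF xR]
      have m: "n - 2 + x \<in> M" using N1[OF RM(2)[OF xR]] xn by auto
      have "x \<noteq> 0"
      proof
        assume "x = 0"
        then have "n - 2 \<in> R" using M1[OF m] RI n by auto
        then show False using R \<open>x = 0\<close> n by fastforce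
      qed
      then have "n - 2 + x = n + (x - 2) \<or> n - 2 + x = n - 1" using n by auto
      then have "n + (x - 2) \<in> M \<or> n - 1 \<in> M" using m by metis
      then have "n - 1 \<in> R"
      proof
        assume "n + (x - 2) \<in> M"
        then show ?thesis by (intro RI[OF M4])
      next
        assume "n - 1 \<in> M"
        then show ?thesis using n by (intro RI[OF M1]) auto
      qed
      then have "x = n - 1" using R by auto
      then have "n - 1 \<in> M" using RM(1)[OF xR] by simp
      then have "(n - 1 + 2 - n, n - 1) \<in> S" using n by (intro M3) auto
      then have "n - 1 + 2 - n = x" by (intro R RI)
      then show False using \<open>x = n - 1\<close> n by linarith
    next
      case True
      have "i0 \<in> R" using ij0 RI by blast
      \<comment> \<open>A single row would meet columns 0 and \<open>n - 1\<close> at its two ends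
        and so be interrupted.\<close>
      have "\<exists>q \<in> R. q \<noteq> i0"
      proof (rule ccontr)
        assume *: "\<not> ?thesis"
        obtain i i' where "(i, 0) \<in> S" "(i', n - 1) \<in> S" using C0 Cn1 by (auto simp: C_def)
        moreover from this have "i = i0" "i' = i0" using * RI by blast+
        ultimately have "(i0, 0) \<in> S" "(i0, n - 1) \<in> S" by simp_all
        then show False using X True by blast
      qed
      then obtain q where q: "q \<in> R" "q \<noteq> i0" by auto
      have notboth: "i \<notin> M \<or> i \<notin> N" if "i \<in> R" for i using X'[OF that] True by auto
      have tM: "x = y" if "x \<in> A - M" "y \<in> A - M" "x \<noteq> n + (n - 1)" "y \<noteq> n + (n - 1)" for x y
        by (rule ccontr, rule three[OF that(1,2) t]) (use that in auto)
      have tN: "x = y" if "x \<in> A - N" "y \<in> A - N" "x \<noteq> n" "y \<noteq> n" for x y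
        by (rule ccontr, rule three[OF that(1,2) b]) (use that in auto)
      have ne: "i \<noteq> n" "i \<noteq> n + (n - 1)" if "i \<in> R" for i using Rn[OF that] by auto
      have A2: "q \<in> A" "i0 \<in> A" using q \<open>i0 \<in> R\<close> AR by simp_all
      have 3: "q \<in> M \<or> i0 \<in> M"
        using tM[of q i0] A2 q(2) ne(2)[OF q(1)] ne(2)[OF \<open>i0 \<in> R\<close>] by auto
      have 4: "q \<in> N \<or> i0 \<in> N"
        using tN[of q i0] A2 q(2) ne(1)[OF q(1)] ne(1)[OF \<open>i0 \<in> R\<close>] by auto
      \<comment> \<open>Each of the two rows is missing from \<open>M\<close> or from
        \<open>N\<close>, and neither set has room for a second missing row. After this the budget
        is spent, so there is no third row.\<close>
      have "\<exists>a c. a \<in> R \<and> c \<in> R \<and> a \<noteq> c \<and> a \<notin> M \<and> c \<notin> N"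
        using notboth[OF q(1)] notboth[OF \<open>i0 \<in> R\<close>] 3 4 q \<open>i0 \<in> R\<close> by metis
      then obtain a c where ac: "a \<in> R" "c \<in> R" "a \<noteq> c" "a \<notin> M" "c \<notin> N" by blast
      have inM: "x \<in> M" if "x \<in> A" "x \<noteq> a" "x \<noteq> n + (n - 1)" for x
        using tM[of x a] that ac(4) AR[OF ac(1)] ne(2)[OF ac(1)] by auto
      have inN: "x \<in> N" if "x \<in> A" "x \<noteq> c" "x \<noteq> n" for x
        using tN[of x c] that ac(5) AR[OF ac(2)] ne(1)[OF ac(2)] by auto
      have Rac: "i = a \<or> i = c" if "i \<in> R" for i
        using inM[of i] inN[of i] notboth[OF that] AR[OF that] ne[OF that] by metis
      \<comment> \<open>The chord leaving column 0 and the chord arriving at column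
        \<open>n - 1\<close> show that the rows \<open>n - 1\<close>, 2 and 0 are met. With only two
        rows this means \<open>n = 3\<close>, and row 2 has both ends in \<open>S\<close>.\<close>
      have "n \<in> M" using inM[of n] AC[OF C0] ne(1)[OF ac(1)] n by auto
      then have 1: "(n - 1, 0) \<in> S" "(2, n - 1) \<in> S" using M4[of 0] M3[of n] by auto
      have "n + (n - 1) \<in> N" using inN[of "n + (n - 1)"] AC[OF Cn1] ne(2)[OF ac(2)] n by auto
      then have "n - 1 - 2 \<in> M" using N2[of "n - 1"] n by simp
      then have 2: "(0, n - 1) \<in> S" using n by (intro M2') auto
      have "n = 3"
        using Rac[OF RI[OF 1(1)]] Rac[OF RI[OF 1(2)]] Rac[OF RI[OF 2]] n by auto
      with 1 X[of 2] True show False by simp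
    qed
  qed
  then obtain i1 where i1: "i1 < n" "\<And>j. j < n \<Longrightarrow> (i1, j) \<in> S" by auto
  have allC: "j \<in> C" if "j < n" for j using i1 CI that by blast
  \<comment> \<open>A full row meets every column, so the last two columns use up the budget for
    \<open>M\<close>: no row is interrupted and every other line met lies in \<open>M\<close>.
    Following the chords that leave from these lines reaches all rows, and both ends of
    each.\<close>
  have t: "n + (n - 1) \<in> A - M" "n + (n - 2) \<in> A - M" using top top2 allC n by auto
  have noX: "i \<notin> X" for i by (rule notI, rule two[OF t(1,2)]) (use n in auto)
  have inM: "x \<in> M" if "x \<in> A" "x \<noteq> n + (n - 1)" "x \<noteq> n + (n - 2)" for x
    by (rule ccontr, rule three[OF t(1,2), of x]) (use that n in auto)
  have inM': "i \<in> M" if "i \<in> R" for i using inM[OF AR[OF that]] Rn[OF that] n by auto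
  have R2: "j + 2 \<in> R" if "j + 2 < n" for j
    using M3[of "n + j"] inM[OF AC[OF allC, of j]] that RI n by auto
  have "(n - 1, 0) \<in> S" using M4[of 0] inM[OF AC[OF allC, of 0]] n by auto
  then have "n - 1 \<in> R" by (rule RI)
  then have R1: "1 \<in> R" using M3[OF inM'] RI n by fastforce
  have "n - 2 \<in> R"
  proof (cases "n = 3")
    case False
    then show ?thesis using R2[of "n - 4"] n by (simp add: numeral_eq_Suc Suc_diff_Suc)
  qed (use R1 in simp)
  then have R0: "0 \<in> R" using M3[OF inM'] RI n by fastforce
  have allR: "i \<in> R" if "i < n" for i
  proof -
    consider "i = 0" | "i = 1" | j where "i = j + 2"
      using le_Suc_ex[of 2 i] by (metis One_nat_def add.commute less_2_cases not_le)
    then show ?thesis using that R0 R1 R2 by cases auto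
  qed
  have "(i, j) \<in> S" if "i < n" "j < n" for i j
  proof -
    have "(i, 0) \<in> S" using M1[OF inM'[OF allR]] that by simp
    moreover have "n - 2 + i \<in> M"
    proof (cases "n - 2 + i < n")
      case True
      then show ?thesis using inM'[OF allR] by simp
    next
      case False
      then have eq: "n - 2 + i = n + (i - 2)" using n by auto
      have "n + (i - 2) \<in> M" by (rule inM[OF AC[OF allC]]) (use \<open>i < n\<close> n in auto)
      then show ?thesis unfolding eq .
    qed
    then have "(i, n - 1) \<in> S" by (rule M3')
    ultimately show ?thesis using spanX noX that by blast
  qed
  then have "{..<n} \<times> {..<n} \<subseteq> S" by auto
  with S show False by auto
qed

text \<open>The right-hand side counts the right ends of maximal runs. Each row met has one at its
  last element, and an interrupted row has another one before a gap.\<close>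

lemma card_row_ends:
  fixes S :: "(nat \<times> nat) set"
  assumes "finite S"
  defines "X \<equiv> {i. \<exists>a b c. a < b \<and> b < c \<and> (i, a) \<in> S \<and> (i, b) \<notin> S \<and> (i, c) \<in> S}"
  shows "card (fst ` S) + card X \<le> card {p \<in> S. (fst p, Suc (snd p)) \<notin> S}"
proof -
  let ?E = "{p \<in> S. (fst p, Suc (snd p)) \<notin> S}"
  define t where "t i = Max {j. (i, j) \<in> S}" for i
  have fin: "finite {j. (i, j) \<in> S}" for i
    by (rule finite_subset[of _ "snd ` S"]) (use assms(1) in force)+
  have t: "(i, t i) \<in> S" "\<And>j. (i, j) \<in> S \<Longrightarrow> j \<le> t i" if "i \<in> fst ` S" for i
  proof -
    have "{j. (i, j) \<in> S} \<noteq> {}" using that by force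
    then show "(i, t i) \<in> S" using Max_in[OF fin[of i]] by (simp add: t_def)
    show "j \<le> t i" if "(i, j) \<in> S" for j using Max_ge[OF fin[of i]] that by (simp add: t_def)
  qed
  have "\<exists>j. (i, j) \<in> ?E \<and> j < t i" if "i \<in> X" for i
  proof -
    from that obtain a b c where abc: "a < b" "b < c" "(i, a) \<in> S" "(i, b) \<notin> S" "(i, c) \<in> S"
      by (auto simp: X_def)
    define j where "j = Max {j. j < b \<and> (i, j) \<in> S}"
    have "finite {j. j < b \<and> (i, j) \<in> S}" by simp
    moreover from abc have "{j. j < b \<and> (i, j) \<in> S} \<noteq> {}" by blast
    ultimately have "j \<in> {j. j < b \<and> (i, j) \<in> S}" "\<And>j'. j' < b \<Longrightarrow> (i, j') \<in> S \<Longrightarrow> j' \<le> j"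
      unfolding j_def by (rule Max_in, simp)
    then have j: "j < b \<and> (i, j) \<in> S" "\<And>j'. j' < b \<Longrightarrow> (i, j') \<in> S \<Longrightarrow> j' \<le> j" by auto
    have "(i, Suc j) \<notin> S"
    proof
      assume "(i, Suc j) \<in> S"
      moreover from this have "Suc j < b" using j(1) abc(4) by (metis Suc_lessI)
      ultimately show False using j(2)[of "Suc j"] by simp
    qed
    moreover have "c \<le> t i" using t(2)[OF _ abc(5)] abc(5) by force
    ultimately have "(i, j) \<in> ?E \<and> j < t i" using j(1) abc(2) by simp
    then show ?thesis ..
  qed
  then obtain g where g: "\<And>i. i \<in> X \<Longrightarrow> (i, g i) \<in> ?E \<and> g i < t i"
    by (metis (no_types, lifting))
  have finX: "finite X"
    by (rule finite_subset[of _ "fst ` S"]) (use assms(1) in \<open>force simp: X_def\<close>)+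
  have "(i, t i) \<in> ?E" if "i \<in> fst ` S" for i
    using t(1)[OF that] t(2)[OF that, of "Suc (t i)"] by auto
  then have "(\<lambda>i. (i, t i)) ` (fst ` S) \<union> (\<lambda>i. (i, g i)) ` X \<subseteq> ?E"
    using g by blast
  then have "card ((\<lambda>i. (i, t i)) ` (fst ` S) \<union> (\<lambda>i. (i, g i)) ` X) \<le> card ?E"
    using assms(1) by (intro card_mono) auto
  moreover have "(\<lambda>i. (i, t i)) ` (fst ` S) \<inter> (\<lambda>i. (i, g i)) ` X = {}"
    using g by fastforce
  ultimately show ?thesis
    using assms(1) finX by (simp add: card_Un_disjoint card_image inj_on_def)
qed

lemma card_column_ends:
  fixes S :: "(nat \<times> nat) set"
  assumes "finite S"
  shows "card (snd ` S) \<le> card {p \<in> S. (Suc (fst p), snd p) \<notin> S}"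
proof -
  have "snd ` S \<subseteq> snd ` {p \<in> S. (Suc (fst p), snd p) \<notin> S}"
  proof
    fix j assume "j \<in> snd ` S"
    then obtain i0 where i0: "(i0, j) \<in> S" by force
    have fin: "finite {i. (i, j) \<in> S}"
      by (rule finite_subset[of _ "fst ` S"]) (use assms(1) in force)+
    define i where "i = Max {i. (i, j) \<in> S}"
    have i: "(i, j) \<in> S" "\<And>i'. (i', j) \<in> S \<Longrightarrow> i' \<le> i"
      using Max_in[OF fin] Max_ge[OF fin] i0 by (auto simp: i_def)
    have "(Suc i, j) \<notin> S" using i(2)[of "Suc i"] by linarith
    then have "(i, j) \<in> {p \<in> S. (Suc (fst p), snd p) \<notin> S}" using i(1) by simp
    then show "j \<in> snd ` {p \<in> S. (Suc (fst p), snd p) \<notin> S}" by force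
  qed
  then show ?thesis using assms by (intro surj_card_le) auto
qed

text \<open>Each vertex of \<open>S\<close> either starts a horizontal edge inside \<open>S\<close>
  or ends a run of its row, and likewise for columns. So \<open>2 * card S\<close> is the number of
  grid edges inside \<open>S\<close> plus the number of runs, and \<open>chord_count\<close>
  compares the runs with the chords.\<close>

lemma augmented_grid_sparse:
  assumes n: "3 \<le> n" and S: "S \<subset> {..<n} \<times> {..<n}" "2 \<le> card S"
  defines "G \<equiv> augmented_grid n (left_bottom n) (\<lambda>k. top_right n (k + 2))"
  shows "card {e \<in> edges G. ends G e \<subseteq> S} + 3 \<le> 2 * card S"
proof -
  have finS: "finite S" using S by (auto dest: finite_subset)
  define M where "M = {k. k < 2 * n - 2 \<and> left_bottom n k \<in> S \<and> top_right n (k + 2) \<in> S}"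
  define H where "H = {p \<in> S. (fst p, Suc (snd p)) \<in> S}"
  define V where "V = {p \<in> S. (Suc (fst p), snd p) \<in> S}"
  have fin: "finite M" "finite H" "finite V"
    using finS by (auto simp: M_def H_def V_def)
  have "{e \<in> edges G. ends G e \<subseteq> S} \<subseteq>
      (\<lambda>(i, j). Horiz i j) ` H \<union> (\<lambda>(i, j). Vert i j) ` V \<union> Chord ` M"
  proof
    fix e assume e: "e \<in> {e \<in> edges G. ends G e \<subseteq> S}"
    show "e \<in> (\<lambda>(i, j). Horiz i j) ` H \<union> (\<lambda>(i, j). Vert i j) ` V \<union> Chord ` M"
      using e by (cases e) (force simp: G_def H_def V_def M_def)+
  qed
  then have "card {e \<in> edges G. ends G e \<subseteq> S} \<le>
      card ((\<lambda>(i, j). Horiz i j) ` H \<union> (\<lambda>(i, j). Vert i j) ` V \<union> Chord ` M)"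
    using fin by (intro card_mono) auto
  also have "\<dots> \<le> card ((\<lambda>(i, j). Horiz i j) ` H) + card ((\<lambda>(i, j). Vert i j) ` V) + card (Chord ` M)"
    by (meson card_Un_le add_mono order_trans order_refl)
  also have "\<dots> \<le> card H + card V + card M"
    using fin by (intro add_mono card_image_le)
  finally have le: "card {e \<in> edges G. ends G e \<subseteq> S} \<le> card H + card V + card M" .
  have "card S = card (H \<union> {p \<in> S. (fst p, Suc (snd p)) \<notin> S})"
    by (rule arg_cong[of _ _ card]) (auto simp: H_def)
  also have "\<dots> = card H + card {p \<in> S. (fst p, Suc (snd p)) \<notin> S}"
    using finS by (intro card_Un_disjoint) (auto simp: H_def)
  finally have cH: "card S = card H + card {p \<in> S. (fst p, Suc (snd p)) \<notin> S}" .
  have "card S = card (V \<union> {p \<in> S. (Suc (fst p), snd p) \<notin> S})"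
    by (rule arg_cong[of _ _ card]) (auto simp: V_def)
  also have "\<dots> = card V + card {p \<in> S. (Suc (fst p), snd p) \<notin> S}"
    using finS by (intro card_Un_disjoint) (auto simp: V_def)
  finally have cV: "card S = card V + card {p \<in> S. (Suc (fst p), snd p) \<notin> S}" .
  show ?thesis
    using le cH cV card_row_ends[OF finS] card_column_ends[OF finS] chord_count[OF n S]
    unfolding M_def by linarith
qed

section \<open>Tightness and degrees of the graph with spiral chords\<close>

lemma valid_chords_spiral:
  assumes "3 \<le> n"
  shows "valid_chords n (left_bottom n) (\<lambda>k. top_right n (k + 2))"
  using assms unfolding valid_chords_def left_bottom_def top_right_def by auto

lemma tight_augmented_grid:
  assumes "1 \<le> n" "valid_chords n a b"
    and "\<And>S. S \<subset> {..<n} \<times> {..<n} \<Longrightarrow> 2 \<le> card S \<Longrightarrow>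
      card {e \<in> edges (augmented_grid n a b). ends (augmented_grid n a b) e \<subseteq> S} + 3 \<le> 2 * card S"
  shows "tight (augmented_grid n a b)"
  unfolding tight_def
  using multigraph_augmented_grid[OF assms(2)] ends_augmented_grid_subset[OF assms(2)] assms(1,3)
    card_edges_augmented_grid[OF assms(1), of a b]
  by (auto simp: card_cartesian_product lessThan_empty_iff)

lemma in_phi4_spiral:
  assumes n: "3 \<le> n"
  shows "in_phi4 (augmented_grid n (left_bottom n) (\<lambda>k. top_right n (k + 2)))" (is "in_phi4 ?G")
  unfolding in_phi4_def
proof
  fix v assume "v \<in> verts ?G"
  then obtain i j where v: "v = (i, j)" "i < n" "j < n" by auto
  \<comment> \<open>On each of its four sides the vertex has a grid edge or the chord of the stub
    there. Truncated subtraction and chord numbers out of range only add spurious members to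
    \<open>P\<close>, which still has at most four.\<close>
  define P where "P = set [if Suc j < n then Horiz i j else Chord (n + i - 2),
     if 0 < j then Horiz i (j - 1) else Chord i,
     if Suc i < n then Vert i j else Chord (n + j),
     if 0 < i then Vert (i - 1) j else Chord (j - 2)]"
  have "{e \<in> edges ?G. v \<in> ends ?G e} \<subseteq> P"
  proof
    fix e assume e: "e \<in> {e \<in> edges ?G. v \<in> ends ?G e}"
    show "e \<in> P"
    proof (cases e)
      case (Chord k)
      with e v have "(i, j) = left_bottom n k \<or> (i, j) = top_right n (k + 2)" by auto
      then show ?thesis using v n Chord
        by (auto simp: P_def left_bottom_def top_right_def split: if_splits)
    qed (use e v in \<open>auto simp: P_def\<close>)
  qed
  then have "card {e \<in> edges ?G. v \<in> ends ?G e} \<le> card P"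
    by (intro card_mono) (auto simp: P_def)
  also have "\<dots> \<le> 4" unfolding P_def by (rule order_trans[OF card_length]) simp
  finally have "card {e \<in> edges ?G. v \<in> ends ?G e} \<le> 4" .
  moreover have "{e \<in> edges ?G. ends ?G e = {v}} = {}"
    using ends_augmented_grid_subset[OF valid_chords_spiral[OF n]] by fastforce
  ultimately show "degree ?G v \<le> 4"
    by (simp only: degree_def card.empty add_0_right)
qed

section \<open>Planarity\<close>

text \<open>The reverse inclusions hold because a curve contains the images of its ends. A vertex on
  a foreign curve also lies on the curve of an edge at that vertex, so \<open>cross\<close> excludes
  it; hence the condition on isolated vertices.\<close>

lemma planarI:
  fixes G :: "('v, 'e) mgraph" and p :: "'v \<Rightarrow> complex" and \<gamma> :: "'e \<Rightarrow> real \<Rightarrow> complex"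
  assumes "multigraph G" and p: "inj_on p (verts G)"
    and edge: "\<And>e. e \<in> edges G \<Longrightarrow> simple_path (\<gamma> e)"
      "\<And>e. e \<in> edges G \<Longrightarrow> {pathstart (\<gamma> e), pathfinish (\<gamma> e)} = p ` ends G e"
    and cross: "\<And>e f. e \<in> edges G \<Longrightarrow> f \<in> edges G \<Longrightarrow> e \<noteq> f \<Longrightarrow>
      path_image (\<gamma> e) \<inter> path_image (\<gamma> f) \<subseteq> p ` (ends G e \<inter> ends G f)"
    and no_isolated: "\<And>v. v \<in> verts G \<Longrightarrow> \<exists>e \<in> edges G. v \<in> ends G e"
  shows "planar G"
proof -
  have sub: "ends G e \<subseteq> verts G" if "e \<in> edges G" for e
    using assms(1) that by (auto simp: multigraph_def)
  have im: "p ` ends G e \<subseteq> path_image (\<gamma> e)" if "e \<in> edges G" for e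
    using edge(2)[OF that, symmetric] pathstart_in_path_image[of "\<gamma> e"] pathfinish_in_path_image[of "\<gamma> e"]
    by simp
  have vert: "path_image (\<gamma> e) \<inter> p ` verts G \<subseteq> p ` ends G e" if e: "e \<in> edges G" for e
  proof
    fix z assume z: "z \<in> path_image (\<gamma> e) \<inter> p ` verts G"
    then obtain v where v: "v \<in> verts G" "z = p v" by auto
    obtain f where f: "f \<in> edges G" "v \<in> ends G f" using no_isolated[OF v(1)] by auto
    show "z \<in> p ` ends G e"
    proof (cases "f = e")
      case False
      have "z \<in> path_image (\<gamma> e) \<inter> path_image (\<gamma> f)" using z im[OF f(1)] f(2) v(2) by auto
      then show ?thesis using cross[OF e f(1)] False by auto
    qed (use f v in simp)
  qed
  show ?thesis unfolding planar_def
  proof (intro exI[of _ p] exI[of _ \<gamma>] conjI ballI impI p)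
    fix e f assume "e \<in> edges G" "f \<in> edges G" "e \<noteq> f"
    then show "path_image (\<gamma> e) \<inter> path_image (\<gamma> f) = p ` (ends G e \<inter> ends G f)"
      using cross[of e f] im[of e] im[of f] by (intro equalityI) blast+
  next
    fix e assume "e \<in> edges G"
    then show "path_image (\<gamma> e) \<inter> p ` verts G = p ` ends G e"
      using vert[of e] im[of e] sub[of e] by blast
  qed (use edge in auto)
qed

text \<open>The first coordinate is an angle of period \<open>w\<close>, the second the logarithm of
  the radius.\<close>

definition cylinder :: "real \<Rightarrow> real \<times> real \<Rightarrow> complex" where
  "cylinder w z = exp (Complex (snd z) (2 * pi * fst z / w))"

lemma cylinder_eq_iff:
  assumes "w > 0"
  shows "cylinder w z = cylinder w z' \<longleftrightarrow> snd z = snd z' \<and> (\<exists>m::int. fst z = fst z' + m * w)"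
proof -
  have "2 * pi * fst z / w = 2 * pi * fst z' / w + of_int (2 * m) * pi \<longleftrightarrow> fst z = fst z' + m * w" for m :: int
  proof -
    have "2 * pi * fst z / w = 2 * pi * fst z' / w + of_int (2 * m) * pi \<longleftrightarrow>
        2 * pi * fst z = 2 * pi * (fst z' + m * w)"
      using assms by (simp add: field_simps)
    then show ?thesis by simp
  qed
  then show ?thesis
    unfolding cylinder_def exp_eq by (auto simp: complex_eq_iff)
qed

lemma abs_int_mult_less_imp_0:
  fixes m :: int and w :: real
  assumes "\<bar>of_int m * w\<bar> < w"
  shows "m = 0"
proof (rule ccontr)
  assume "m \<noteq> 0"
  then have "1 \<le> \<bar>real_of_int m\<bar>" by linarith
  moreover have "0 < w" using assms by linarith
  ultimately have "1 * w \<le> \<bar>real_of_int m\<bar> * w" by (intro mult_right_mono) auto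
  with assms \<open>0 < w\<close> show False by (simp add: abs_mult)
qed

lemma continuous_on_cylinder: "continuous_on A (cylinder w)"
proof -
  have "cylinder w = (\<lambda>z. exp (complex_of_real (snd z) + \<i> * complex_of_real (2 * pi * fst z / w)))"
    by (rule ext) (simp only: cylinder_def Complex_eq)
  moreover have "continuous_on A (\<lambda>z. exp (complex_of_real (snd z) + \<i> * complex_of_real (2 * pi * fst z / w)))"
    unfolding divide_inverse by (intro continuous_intros)
  ultimately show ?thesis by simp
qed

text \<open>Points of the segment with equal images have equal height and differ horizontally by a
  multiple of \<open>w\<close>. A sloping segment takes each height once; a level one is too short
  to wrap around.\<close>

lemma simple_path_cylinder_linepath:
  assumes w: "w > 0" and ab: "a \<noteq> b" "\<bar>fst a - fst b\<bar> < w \<or> snd a \<noteq> snd b"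
  shows "simple_path (cylinder w \<circ> linepath a b)"
proof -
  have "inj_on (cylinder w \<circ> linepath a b) {0..1}"
  proof (rule inj_onI)
    fix x y :: real assume xy: "x \<in> {0..1}" "y \<in> {0..1}"
      and "(cylinder w \<circ> linepath a b) x = (cylinder w \<circ> linepath a b) y"
    then obtain m :: int where
      "snd (linepath a b x) = snd (linepath a b y)" "fst (linepath a b x) = fst (linepath a b y) + m * w"
      unfolding o_def cylinder_eq_iff[OF w] by auto
    then have 1: "(x - y) * (snd b - snd a) = 0" and 2: "(x - y) * (fst b - fst a) = m * w"
      by (simp_all add: linepath_def algebra_simps)
    show "x = y"
    proof (cases "snd a = snd b")
      case True
      then have lt: "\<bar>fst b - fst a\<bar> < w" and ne: "fst a \<noteq> fst b" using ab by (auto simp: prod_eq_iff)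
      have "\<bar>x - y\<bar> \<le> 1" using xy by auto
      then have "\<bar>x - y\<bar> * \<bar>fst b - fst a\<bar> \<le> 1 * \<bar>fst b - fst a\<bar>" by (rule mult_right_mono) simp
      also have "\<bar>x - y\<bar> * \<bar>fst b - fst a\<bar> = \<bar>of_int m * w\<bar>" using 2 by (simp flip: abs_mult)
      finally have "\<bar>of_int m * w\<bar> < w" using lt by simp
      then have "m = 0" by (rule abs_int_mult_less_imp_0)
      then show ?thesis using 2 ne by simp
    qed (use 1 in simp)
  qed
  moreover have "path (cylinder w \<circ> linepath a b)"
    by (intro path_continuous_image continuous_on_cylinder path_linepath)
  ultimately show ?thesis by (simp add: arc_def arc_imp_simple_path)
qed

text \<open>The grid becomes a diamond with \<open>left_bottom\<close> on its left sides and
  \<open>top_right\<close> on its right sides, both running upwards. Chords can leave on the right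
  and return from the left around the cylinder.\<close>

definition grid_pos :: "nat \<times> nat \<Rightarrow> real \<times> real" where
  "grid_pos v = (real (snd v) - real (fst v), real (fst v) + real (snd v))"

lemma cylinder_grid_pos_eqD:
  assumes "n \<ge> 1" "cylinder (4 * real n) z = cylinder (4 * real n) z'"
    "\<bar>fst z\<bar> \<le> real n - 1" "\<bar>fst z'\<bar> \<le> real n - 1"
  shows "z = z'"
proof -
  obtain m :: int where m: "snd z = snd z'" "fst z = fst z' + m * (4 * real n)"
    using assms(1,2) by (auto simp: cylinder_eq_iff)
  then have "\<bar>of_int m * (4 * real n)\<bar> \<le> 2 * real n - 2" using assms(3,4) by linarith
  moreover have "2 * real n - 2 < 4 * real n" by simp
  ultimately have "\<bar>of_int m * (4 * real n)\<bar> < 4 * real n" by (rule le_less_trans)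
  then have "m = 0" by (rule abs_int_mult_less_imp_0)
  with m show ?thesis by (simp add: prod_eq_iff)
qed

lemma grid_pos_bound: "v \<in> {..<n} \<times> {..<n} \<Longrightarrow> \<bar>fst (grid_pos v)\<bar> \<le> real n - 1"
  by (auto simp: grid_pos_def)

lemma inj_cylinder_grid_pos:
  assumes "n \<ge> 1"
  shows "inj_on (cylinder (4 * real n) \<circ> grid_pos) ({..<n} \<times> {..<n})"
proof (rule inj_onI)
  fix u v assume uv: "u \<in> {..<n} \<times> {..<n}" "v \<in> {..<n} \<times> {..<n}"
    "(cylinder (4 * real n) \<circ> grid_pos) u = (cylinder (4 * real n) \<circ> grid_pos) v"
  then have "grid_pos u = grid_pos v"
    using cylinder_grid_pos_eqD[OF assms, of "grid_pos u" "grid_pos v"] grid_pos_bound by simp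
  then show "u = v" by (auto simp: grid_pos_def prod_eq_iff)
qed

section \<open>Grid links as straight segments\<close>

fun grid_link :: "link \<Rightarrow> bool" where
  "grid_link (Chord k) = False"
| "grid_link _ = True"

text \<open>The value on chords is a placeholder; \<open>planar_augmented_grid\<close> draws them
  separately.\<close>

fun grid_segment :: "link \<Rightarrow> real \<Rightarrow> real \<times> real" where
  "grid_segment (Horiz i j) = linepath (grid_pos (i, j)) (grid_pos (i, Suc j))"
| "grid_segment (Vert i j) = linepath (grid_pos (i, j)) (grid_pos (Suc i, j))"
| "grid_segment (Chord k) = linepath 0 0"

lemma grid_segment_altdef:
  "grid_segment (Horiz i j) x = (real j + x - real i, real i + real j + x)"
  "grid_segment (Vert i j) x = (real j - real i - x, real i + x + real j)"
  by (simp_all add: linepath_def grid_pos_def algebra_simps)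

text \<open>The inequalities describe the diamond. Its sides have slope 1 or -1, and the spiral
  chords will be flatter.\<close>

lemma grid_segment_bounds:
  assumes "e \<in> edges (augmented_grid n a b)" "grid_link e" "x \<in> {0..1}"
  shows "\<bar>fst (grid_segment e x)\<bar> \<le> snd (grid_segment e x)"
    "\<bar>fst (grid_segment e x)\<bar> \<le> 2 * real n - 2 - snd (grid_segment e x)"
proof -
  have nat: "real i + 1 \<le> real n" if "i < n" for i using that by linarith
  have nat': "real i + 2 \<le> real n" if "Suc i < n" for i using that by linarith
  show "\<bar>fst (grid_segment e x)\<bar> \<le> snd (grid_segment e x)"
    using assms by (cases e) (auto simp: grid_segment_altdef simp del: grid_segment.simps)
  show "\<bar>fst (grid_segment e x)\<bar> \<le> 2 * real n - 2 - snd (grid_segment e x)"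
    using assms by (cases e)
      (auto simp: grid_segment_altdef simp del: grid_segment.simps dest!: nat nat' split: abs_split)
qed

lemma grid_segment_bound:
  assumes "e \<in> edges (augmented_grid n a b)" "grid_link e" "x \<in> {0..1}"
  shows "\<bar>fst (grid_segment e x)\<bar> \<le> real n - 1"
  using grid_segment_bounds[OF assms] by linarith

lemma real_between_nats:
  fixes i j :: nat and x :: real
  assumes "real i = real j + x" "x \<in> {0..1}"
  shows "i = j \<and> x = 0 \<or> i = Suc j \<and> x = 1"
proof -
  have "real i \<le> real (Suc j)" "real j \<le> real i" using assms by auto
  then have "i = j \<or> i = Suc j" by linarith
  with assms show ?thesis by auto
qed

lemma unit_intervals_meet:
  fixes i j :: nat and x y :: real
  assumes "real i + x = real j + y" "x \<in> {0..1}" "y \<in> {0..1}" "i \<noteq> j"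
  shows "i = Suc j \<and> x = 0 \<or> j = Suc i \<and> x = 1"
proof -
  have "real i \<le> real (Suc j)" "real j \<le> real (Suc i)" using assms by auto
  with assms(4) have "i = Suc j \<or> j = Suc i" by linarith
  with assms show ?thesis by auto
qed

lemma grid_segment_vertex:
  assumes "grid_link e" "x \<in> {0..1}" "grid_segment e x = grid_pos v"
  shows "v \<in> ends (augmented_grid n a b) e"
proof (cases e)
  case (Horiz i j)
  with assms have "real (fst v) = real i" "real (snd v) = real j + x"
    by (auto simp: grid_segment_altdef grid_pos_def simp del: grid_segment.simps)
  with real_between_nats[OF this(2) assms(2)] Horiz show ?thesis by (auto simp: prod_eq_iff)
next
  case (Vert i j)
  with assms have "real (snd v) = real j" "real (fst v) = real i + x"
    by (auto simp: grid_segment_altdef grid_pos_def simp del: grid_segment.simps)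
  with real_between_nats[OF this(2) assms(2)] Vert show ?thesis by (auto simp: prod_eq_iff)
qed (use assms in simp)

text \<open>Parallel links meet only in a common end; where a horizontal and a vertical link meet,
  one fixes the row and the other the column.\<close>

lemma grid_segments_meet:
  assumes "grid_link e" "grid_link f" "e \<noteq> f" "x \<in> {0..1}" "y \<in> {0..1}"
    "grid_segment e x = grid_segment f y"
  shows "\<exists>v. grid_segment e x = grid_pos v"
proof (cases e)
  case e: (Horiz i j)
  show ?thesis
  proof (cases f)
    case f: (Horiz i' j')
    have "real i = real i'" "real j + x = real j' + y"
      using assms(6) by (auto simp: e f grid_segment_altdef simp del: grid_segment.simps)
    with unit_intervals_meet[OF this(2) assms(4,5)] assms(3) e f have "x = 0 \<or> x = 1" by auto
    then have "grid_segment e x = grid_pos (i, j) \<or> grid_segment e x = grid_pos (i, Suc j)"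
      by (auto simp: e linepath_def)
    then show ?thesis by blast
  next
    case f: (Vert i' j')
    have "real i = real i' + y" "real j' = real j + x"
      using assms(6) by (auto simp: e f grid_segment_altdef simp del: grid_segment.simps)
    then have "grid_segment e x = grid_pos (i, j')"
      by (simp add: e grid_segment_altdef grid_pos_def del: grid_segment.simps)
    then show ?thesis ..
  qed (use assms in simp)
next
  case e: (Vert i j)
  show ?thesis
  proof (cases f)
    case f: (Vert i' j')
    have "real j = real j'" "real i + x = real i' + y"
      using assms(6) by (auto simp: e f grid_segment_altdef simp del: grid_segment.simps)
    with unit_intervals_meet[OF this(2) assms(4,5)] assms(3) e f have "x = 0 \<or> x = 1" by auto
    then have "grid_segment e x = grid_pos (i, j) \<or> grid_segment e x = grid_pos (Suc i, j)"
      by (auto simp: e linepath_def)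
    then show ?thesis by blast
  next
    case f: (Horiz i' j')
    have "real i' = real i + x" "real j = real j' + y"
      using assms(6) by (auto simp: e f grid_segment_altdef simp del: grid_segment.simps)
    then have "grid_segment e x = grid_pos (i', j)"
      by (simp add: e grid_segment_altdef grid_pos_def del: grid_segment.simps)
    then show ?thesis ..
  qed (use assms in simp)
qed (use assms in simp)

text \<open>Planarity is reduced to the chords: chord \<open>k\<close> is the segment from
  \<open>b k\<close> to the copy of \<open>a k\<close> shifted by \<open>c k\<close> full turns. It
  is enough to confine meetings to the ends of segments, since these are vertices and vertices have
  distinct positions.\<close>

lemma planar_augmented_grid:
  fixes n :: nat and a b :: "nat \<Rightarrow> nat \<times> nat" and c :: "nat \<Rightarrow> int"
  assumes n: "2 \<le> n" and valid: "valid_chords n a b"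
  defines "w \<equiv> 4 * real n"
    and "\<kappa> \<equiv> \<lambda>k. linepath (grid_pos (b k)) (grid_pos (a k) + (of_int (c k) * (4 * real n), 0))"
  assumes simple: "\<And>k. k < 2 * n - 2 \<Longrightarrow> simple_path (cylinder w \<circ> \<kappa> k)"
    and chord_grid: "\<And>k e x y. k < 2 * n - 2 \<Longrightarrow> e \<in> edges (augmented_grid n a b) \<Longrightarrow> grid_link e \<Longrightarrow>
      x \<in> {0..1} \<Longrightarrow> y \<in> {0..1} \<Longrightarrow> cylinder w (\<kappa> k x) = cylinder w (grid_segment e y) \<Longrightarrow>
      x = 0 \<or> x = 1"
    and chord_chord: "\<And>k l x y. k < l \<Longrightarrow> l < 2 * n - 2 \<Longrightarrow> x \<in> {0..1} \<Longrightarrow> y \<in> {0..1} \<Longrightarrow>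
      cylinder w (\<kappa> k x) = cylinder w (\<kappa> l y) \<Longrightarrow> x \<in> {0, 1} \<and> y \<in> {0, 1}"
  shows "planar (augmented_grid n a b)"
proof -
  let ?G = "augmented_grid n a b"
  define p where "p = cylinder w \<circ> grid_pos"
  define \<gamma> where "\<gamma> e = cylinder w \<circ> (case e of Chord k \<Rightarrow> \<kappa> k | _ \<Rightarrow> grid_segment e)" for e
  have w: "w > 0" using n by (simp add: w_def)
  have p: "inj_on p (verts ?G)"
    using inj_cylinder_grid_pos[of n] n by (simp add: p_def w_def)
  have sub: "ends ?G e \<subseteq> verts ?G" if "e \<in> edges ?G" for e
    using ends_augmented_grid_subset[OF valid that] by simp
  have shift: "cylinder w (z + (of_int m * (4 * real n), 0)) = cylinder w z" for z and m :: int
    using w by (auto simp: cylinder_eq_iff w_def)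
  have \<kappa>01: "cylinder w (\<kappa> k 0) = p (b k)" "cylinder w (\<kappa> k 1) = p (a k)" for k
    by (simp_all add: \<kappa>_def linepath_def p_def shift)
  have \<gamma>: "\<gamma> (Chord k) = cylinder w \<circ> \<kappa> k" "grid_link e \<Longrightarrow> \<gamma> e = cylinder w \<circ> grid_segment e" for k e
    by (cases e; simp add: \<gamma>_def)+
  have ends: "{pathstart (\<gamma> e), pathfinish (\<gamma> e)} = p ` ends ?G e" for e
    by (cases e) (auto simp: \<gamma> pathstart_def pathfinish_def \<kappa>01 linepath_def p_def)
  have vertex: "v \<in> ends ?G e"
    if "e \<in> edges ?G" "grid_link e" "y \<in> {0..1}" "cylinder w (grid_segment e y) = p v" "v \<in> verts ?G" for e y v
  proof -
    have "grid_segment e y = grid_pos v"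
      using cylinder_grid_pos_eqD[of n "grid_segment e y" "grid_pos v"] grid_segment_bound[OF that(1-3)]
        grid_pos_bound[of v n] that(4,5) n by (simp add: p_def w_def)
    then show ?thesis using grid_segment_vertex that(2,3) by blast
  qed
  \<comment> \<open>By symmetry \<open>f\<close> may be assumed to be a chord whenever
    \<open>e\<close> is one, and two chords to come in increasing order.\<close>
  have cross: "z \<in> p ` (ends ?G e \<inter> ends ?G f)"
    if e: "e \<in> edges ?G" and f: "f \<in> edges ?G" and ne: "e \<noteq> f"
      and z: "z = \<gamma> e x" "z = \<gamma> f y" and xy: "x \<in> {0..1}" "y \<in> {0..1}"
      and ord: "grid_link f \<longrightarrow> grid_link e" "\<And>k l. e = Chord k \<Longrightarrow> f = Chord l \<Longrightarrow> k < l" for e f x y z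
  proof (cases "grid_link f")
    case True
    then have ef: "grid_link e" "grid_link f" using ord by auto
    then have "grid_segment e x = grid_segment f y"
      using cylinder_grid_pos_eqD[of n "grid_segment e x" "grid_segment f y"]
        grid_segment_bound[OF e _ xy(1)] grid_segment_bound[OF f _ xy(2)] z n
      by (simp add: \<gamma> w_def)
    moreover from grid_segments_meet[OF ef ne xy this]
    obtain v where v: "grid_segment e x = grid_pos v" by blast
    ultimately have "v \<in> ends ?G e" "v \<in> ends ?G f"
      using grid_segment_vertex ef xy by metis+
    moreover have "z = p v" using z v ef by (simp add: \<gamma> p_def)
    ultimately show ?thesis by blast
  next
    case False
    then obtain l where l: "f = Chord l" by (cases f) auto
    with f have l': "l < 2 * n - 2" by simp
    show ?thesis
    proof (cases "grid_link e")
      case True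
      have "y = 0 \<or> y = 1"
        using chord_grid[OF l' e True xy(2,1)] z True l by (simp add: \<gamma>)
      then have "z \<in> p ` ends ?G f" using z l by (auto simp: \<gamma> \<kappa>01)
      then obtain v where v: "v \<in> ends ?G f" "z = p v" by blast
      moreover have "v \<in> ends ?G e"
        using vertex[OF e True xy(1), of v] v z True sub[OF f] by (auto simp: \<gamma>)
      ultimately show ?thesis by blast
    next
      case False
      then obtain k where k: "e = Chord k" by (cases e) auto
      have "x \<in> {0, 1} \<and> y \<in> {0, 1}"
        using chord_chord[OF ord(2)[OF k l] l' xy] z k l by (simp add: \<gamma>)
      then have "z \<in> p ` ends ?G e" "z \<in> p ` ends ?G f"
        using z k l by (auto simp: \<gamma> \<kappa>01)
      then show ?thesis
        using inj_on_image_Int[OF p sub[OF e] sub[OF f]] by blast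
    qed
  qed
  show ?thesis
  proof (rule planarI[where p = p and \<gamma> = \<gamma>])
    show "multigraph ?G" using valid by (rule multigraph_augmented_grid)
    show "inj_on p (verts ?G)" by (rule p)
    show "simple_path (\<gamma> e)" if "e \<in> edges ?G" for e
    proof (cases e)
      case (Chord k)
      then show ?thesis using simple that by (simp add: \<gamma>)
    qed (auto simp: \<gamma> grid_pos_def intro!: simple_path_cylinder_linepath w)
    show "{pathstart (\<gamma> e), pathfinish (\<gamma> e)} = p ` ends ?G e" for e by (rule ends)
  next
    fix e f assume e: "e \<in> edges ?G" and f: "f \<in> edges ?G" and ne: "e \<noteq> f"
    show "path_image (\<gamma> e) \<inter> path_image (\<gamma> f) \<subseteq> p ` (ends ?G e \<inter> ends ?G f)"
    proof
      fix z assume "z \<in> path_image (\<gamma> e) \<inter> path_image (\<gamma> f)"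
      then obtain x y where xy: "x \<in> {0..1}" "z = \<gamma> e x" "y \<in> {0..1}" "z = \<gamma> f y"
        by (auto simp: path_image_def)
      consider "(grid_link f \<longrightarrow> grid_link e) \<and> (\<forall>k l. e = Chord k \<longrightarrow> f = Chord l \<longrightarrow> k < l)"
        | "(grid_link e \<longrightarrow> grid_link f) \<and> (\<forall>k l. f = Chord k \<longrightarrow> e = Chord l \<longrightarrow> k < l)"
        using ne by (cases e; cases f) (auto elim: linorder_neqE_nat)
      then show "z \<in> p ` (ends ?G e \<inter> ends ?G f)"
      proof cases
        case 1
        then show ?thesis using cross[OF e f ne xy(2,4,1,3)] by blast
      next
        case 2
        then show ?thesis using cross[OF f e ne[symmetric] xy(4,2,3,1)] by (simp add: Int_commute)
      qed
    qed
  next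
    fix v assume "v \<in> verts ?G"
    then obtain i j where v: "v = (i, j)" "i < n" "j < n" by auto
    show "\<exists>e \<in> edges ?G. v \<in> ends ?G e"
    proof (cases "Suc j < n")
      case True
      then show ?thesis using v by (intro bexI[of _ "Horiz i j"]) auto
    next
      case False
      then show ?thesis using v n by (intro bexI[of _ "Horiz i (j - 1)"]) auto
    qed
  qed
qed

lemma planar_spiral:
  assumes n: "3 \<le> n"
  shows "planar (augmented_grid n (left_bottom n) (\<lambda>k. top_right n (k + 2)))"
proof -
  define w where "w = 4 * real n"
  \<comment> \<open>Chord \<open>k\<close> runs from \<open>(su k, tu k)\<close> on the right of the
    diamond to \<open>(sl k + w, tl k)\<close> on the left of its next copy; \<open>W k\<close> is
    its horizontal extent and \<open>d k\<close> its descent.\<close>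
  define sl tl where "sl k = fst (grid_pos (left_bottom n k))" and "tl k = snd (grid_pos (left_bottom n k))" for k
  define su tu where "su k = fst (grid_pos (top_right n (k + 2)))" and "tu k = snd (grid_pos (top_right n (k + 2)))" for k
  define \<kappa> where "\<kappa> k = linepath (grid_pos (top_right n (k + 2)))
    (grid_pos (left_bottom n k) + (of_int 1 * (4 * real n), 0))" for k
  define W where "W k = sl k + w - su k" for k
  define d where "d k = tu k - tl k" for k
  have n': "3 \<le> real n" using n by simp
  have left: "k < n \<and> sl k = - real k \<and> tl k = real k \<or>
      n \<le> k \<and> sl k = real k + 1 - 2 * real n \<and> tl k = real k - 1" if "k < 2 * n - 2" for k
    using that n by (auto simp: sl_def tl_def left_bottom_def grid_pos_def of_nat_diff)
  have right: "k + 2 < n \<and> su k = real k + 2 \<and> tu k = real k + 2 \<or>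
      n \<le> k + 2 \<and> su k = 2 * real n - 3 - real k \<and> tu k = real k + 1" if "k < 2 * n - 2" for k
    using that n by (auto simp: su_def tu_def top_right_def grid_pos_def of_nat_diff)
  have bounds: "1 \<le> d k \<and> d k \<le> 2 \<and> 2 < W k \<and> sl k \<le> 0 \<and> 0 \<le> su k \<and> su k \<le> w \<and> 0 \<le> sl k + w"
    if "k < 2 * n - 2" for k
  proof -
    have "real k + 3 \<le> 2 * real n" using that by linarith
    moreover have "k < n \<Longrightarrow> real k + 1 \<le> real n" "k + 2 < n \<Longrightarrow> real k + 3 \<le> real n"
      "n \<le> k \<Longrightarrow> real n \<le> real k" "n \<le> k + 2 \<Longrightarrow> real n \<le> real k + 2" by linarith+
    ultimately show ?thesis
      using left[OF that] right[OF that] n' unfolding d_def W_def w_def by linarith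
  qed
  have \<kappa>: "fst (\<kappa> k x) = su k + x * W k" "snd (\<kappa> k x) = tu k - x * d k" for k x
    by (simp_all add: \<kappa>_def linepath_def sl_def su_def tl_def tu_def W_def d_def w_def algebra_simps)
  have strip: "0 \<le> fst (\<kappa> k x) \<and> fst (\<kappa> k x) \<le> w" if "k < 2 * n - 2" "x \<in> {0..1}" for k x
  proof -
    have "0 \<le> x * W k" "x * W k \<le> W k"
      using that bounds[OF that(1)] by (auto intro!: mult_left_le_one_le)
    then show ?thesis using bounds[OF that(1)] W_def[of k] unfolding \<kappa> by linarith
  qed
  show ?thesis
  proof (rule planar_augmented_grid[where c = "\<lambda>_. 1"], fold \<kappa>_def, fold w_def)
    show "2 \<le> n" using n by simp
    show "valid_chords n (left_bottom n) (\<lambda>k. top_right n (k + 2))"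
      using n by (rule valid_chords_spiral)
  next
    fix k assume k: "k < 2 * n - 2"
    then show "simple_path (cylinder w \<circ> \<kappa> k)"
      using bounds[OF k] n unfolding \<kappa>_def
      by (intro simple_path_cylinder_linepath)
        (auto simp: w_def d_def tu_def tl_def prod_eq_iff)
  next
    fix k e x y
    assume k: "k < 2 * n - 2" and e: "e \<in> edges (augmented_grid n (left_bottom n) (\<lambda>k. top_right n (k + 2)))"
      "grid_link e" and xy: "x \<in> {0..1}" "y \<in> {0..1}"
      and eq: "cylinder w (\<kappa> k x) = cylinder w (grid_segment e y)"
    note g = grid_segment_bounds[OF e xy(2)] grid_segment_bound[OF e xy(2)]
    obtain m :: int where m: "snd (\<kappa> k x) = snd (grid_segment e y)"
      "fst (\<kappa> k x) = fst (grid_segment e y) + m * w"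
      using eq n by (auto simp: cylinder_eq_iff w_def)
    \<comment> \<open>The chord stays within one period, so it can meet only the diamond and its
      next copy. As \<open>d k < W k\<close>, it is flatter than their sides and touches the first
      only at its start and the second only at its end.\<close>
    have "m = 0 \<or> m = 1"
    proof -
      have w: "0 \<le> w" "real n - 1 < w" using n' by (simp_all add: w_def)
      then have "-1 * w < m * w" "m * w < 2 * w"
        using strip[OF k xy(1)] g(3) m(2) by linarith+
      then have "- 1 < real_of_int m" "real_of_int m < 2"
        using mult_right_less_imp_less w(1) by blast+
      then show ?thesis by linarith
    qed
    then show "x = 0 \<or> x = 1"
    proof
      assume "m = 0"
      then have "x * (W k - d k) \<le> 0 \<or> x * (W k + d k) \<le> 0"
        using m g(1,2) right[OF k] unfolding \<kappa> by (auto simp: algebra_simps)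
      then show ?thesis using bounds[OF k] xy by (auto simp: mult_le_0_iff)
    next
      assume "m = 1"
      then have "(1 - x) * (W k - d k) \<le> 0 \<or> (1 - x) * (W k + d k) \<le> 0"
        using m g(1,2) left[OF k] unfolding \<kappa> by (auto simp: algebra_simps W_def d_def)
      then show ?thesis using bounds[OF k] xy by (auto simp: mult_le_0_iff)
    qed
  next
    fix k l x y
    assume kl: "k < l" "l < 2 * n - 2" and xy: "x \<in> {0..1}" "y \<in> {0..1}"
      and eq: "cylinder w (\<kappa> k x) = cylinder w (\<kappa> l y)"
    have k: "k < 2 * n - 2" using kl by simp
    obtain m :: int where m: "snd (\<kappa> k x) = snd (\<kappa> l y)" "fst (\<kappa> k x) = fst (\<kappa> l y) + m * w"
      using eq n by (auto simp: cylinder_eq_iff w_def)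
    \<comment> \<open>A chord reaches the right end of the period only at height 0 and the left end
      only at another height, so no two chords meet across the seam.\<close>
    have right_end: "snd (\<kappa> i z) = 0" if i: "i < 2 * n - 2" "z \<in> {0..1}" "fst (\<kappa> i z) = w" for i z
    proof -
      have "(1 - z) * W i = sl i" using i(3) unfolding \<kappa> W_def by (simp add: algebra_simps)
      moreover have "0 \<le> (1 - z) * W i" using i(2) bounds[OF i(1)] by simp
      ultimately have "sl i = 0" "(1 - z) * W i = 0" using bounds[OF i(1)] by auto
      then have "z = 1" "tl i = 0" using left[OF i(1)] bounds[OF i(1)] i(1) by auto
      then show ?thesis by (simp add: \<kappa> d_def)
    qed
    have left_end: "snd (\<kappa> i z) \<noteq> 0" if i: "i < 2 * n - 2" "z \<in> {0..1}" "fst (\<kappa> i z) = 0" for i z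
    proof -
      have "0 \<le> z * W i" using i(2) bounds[OF i(1)] by simp
      then have "z * W i = 0" using i(3) bounds[OF i(1)] unfolding \<kappa> by linarith
      then have "z = 0" using bounds[OF i(1)] by auto
      then show ?thesis using right[OF i(1)] by (auto simp: \<kappa>)
    qed
    have "m = 0"
    proof (rule ccontr)
      assume "m \<noteq> 0"
      then have "1 \<le> m \<or> m \<le> -1" by linarith
      then show False
      proof
        assume "1 \<le> m"
        then have "1 * w \<le> m * w" using n by (intro mult_right_mono) (auto simp: w_def)
        then have "fst (\<kappa> k x) = w" "fst (\<kappa> l y) = 0"
          using strip[OF k xy(1)] strip[OF kl(2) xy(2)] m(2) by linarith+
        then show False using right_end[OF k xy(1)] left_end[OF kl(2) xy(2)] m(1) by simp
      next
        assume "m \<le> -1"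
        then have "m * w \<le> - 1 * w" using n by (intro mult_right_mono) (auto simp: w_def)
        then have "fst (\<kappa> l y) = w" "fst (\<kappa> k x) = 0"
          using strip[OF k xy(1)] strip[OF kl(2) xy(2)] m(2) by linarith+
        then show False using right_end[OF kl(2) xy(2)] left_end[OF k xy(1)] m(1) by simp
      qed
    qed
    \<comment> \<open>\<open>f\<close> is constant on chord \<open>k\<close> and at least as large at both ends of chord \<open>l\<close>.\<close>
    define f where "f s t = W k * t + d k * s" for s t
    have fk: "f (fst (\<kappa> k x)) (snd (\<kappa> k x)) = f (su k) (tu k)"
      by (simp add: f_def \<kappa> algebra_simps)
    have shifted: "sl i + w = su i + W i" "tl i = tu i - d i" for i by (simp_all add: W_def d_def)
    have fk': "f (sl k + w) (tl k) = f (su k) (tu k)"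
      unfolding shifted by (simp add: f_def algebra_simps)
    have fl: "f (fst (\<kappa> l y)) (snd (\<kappa> l y)) = (1 - y) * f (su l) (tu l) + y * f (sl l + w) (tl l)"
      unfolding shifted by (simp add: f_def \<kappa> algebra_simps)
    have kl': "real k + 1 \<le> real l" using kl by linarith
    \<comment> \<open>As \<open>d k < W k\<close>, the functional is nonnegative on displacements
      that rise at least as steeply as the sides of the diamond. Passing to a larger stub number
      gives such a displacement at either end.\<close>
    have above: "0 \<le> W k * dt + d k * ds \<and> (dt \<noteq> 0 \<longrightarrow> 0 < W k * dt + d k * ds)"
      if "\<bar>ds\<bar> \<le> dt" for ds dt
    proof -
      have "d k * \<bar>ds\<bar> \<le> d k * dt" using that bounds[OF k] by (intro mult_left_mono) auto
      moreover have "\<bar>d k * ds\<bar> = d k * \<bar>ds\<bar>" using bounds[OF k] by (simp add: abs_mult)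
      moreover have "0 \<le> (W k - d k) * dt" "dt \<noteq> 0 \<Longrightarrow> 0 < (W k - d k) * dt"
        using that bounds[OF k] by auto
      ultimately show ?thesis by (auto simp: algebra_simps)
    qed
    have "\<bar>su l - su k\<bar> \<le> tu l - tu k" "\<bar>sl l - sl k\<bar> \<le> tl l - tl k"
      using right[OF k] right[OF kl(2)] left[OF k] left[OF kl(2)] kl' kl by (auto split: abs_split)
    note a = this above[OF this(1)] above[OF this(2)]
    have fu: "f (su l) (tu l) - f (su k) (tu k) = W k * (tu l - tu k) + d k * (su l - su k)"
      by (simp add: f_def algebra_simps)
    have fsl: "f (sl l + w) (tl l) - f (su k) (tu k) = W k * (tl l - tl k) + d k * (sl l - sl k)"
      unfolding fk'[symmetric] by (simp add: f_def algebra_simps)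
    have sum0: "(1 - y) * (f (su l) (tu l) - f (su k) (tu k)) + y * (f (sl l + w) (tl l) - f (su k) (tu k)) = 0"
      using fk fl m \<open>m = 0\<close> by (simp add: algebra_simps)
    \<comment> \<open>The value at a point of chord \<open>l\<close> is a convex combination of the
      values at its ends, so both nonnegative terms vanish.\<close>
    have parts: "(1 - y) * (f (su l) (tu l) - f (su k) (tu k)) = 0" "y * (f (sl l + w) (tl l) - f (su k) (tu k)) = 0"
      using sum0 a(3,4) xy(2) unfolding fu fsl
      by (smt (verit) mult_nonneg_nonneg atLeastAtMost_iff)+
    show "x \<in> {0, 1} \<and> y \<in> {0, 1}"
    proof (cases "y = 1")
      case True
      then have "tl l = tl k" "sl l = sl k" using parts(2) a(2,4) unfolding fsl by auto
      then have "(1 - x) * d k = 0" using m(1) True unfolding \<kappa> d_def by (simp add: algebra_simps)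
      then show ?thesis using True bounds[OF k] by auto
    next
      case False
      then have "f (su l) (tu l) - f (su k) (tu k) = 0" using parts(1) by simp
      then have 1: "tu l = tu k" "su l = su k" using a(1,3) unfolding fu by auto
      have "y = 0 \<or> tl l = tl k"
        using parts(2) a(4) unfolding fsl by auto
      \<comment> \<open>Stubs of the same kind share a vertex only for the numbers
        \<open>n - 1\<close> and \<open>n\<close>. Because of the shift by 2, these belong to the
        chords \<open>n - 3\<close> and \<open>n - 2\<close> on the right but \<open>n - 1\<close>
        and \<open>n\<close> on the left, so no two chords share both ends.\<close>
      moreover have "tl l \<noteq> tl k"
        using 1 left[OF k] left[OF kl(2)] right[OF k] right[OF kl(2)] kl' n kl by auto
      ultimately have "y = 0" by simp
      then have "x * d k = 0" using m(1) 1 unfolding \<kappa> by simp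
      then show ?thesis using \<open>y = 0\<close> bounds[OF k] by auto
    qed
  qed
qed

section \<open>Small grids and the theorem\<close>

lemma augmented_grid_1:
  fixes a b :: "nat \<Rightarrow> nat \<times> nat"
  defines "G \<equiv> augmented_grid 1 a b"
  shows "valid_chords 1 a b" "tight G" "planar G" "in_phi4 G"
proof -
  have E: "edges G = {}" by (simp add: G_def edges_augmented_grid)
  show v: "valid_chords 1 a b" by (simp add: valid_chords_def)
  show "tight G" unfolding G_def
  proof (rule tight_augmented_grid[OF _ v])
    fix S :: "(nat \<times> nat) set"
    assume S: "S \<subset> {..<1} \<times> {..<1}" "2 \<le> card S"
    then have "card S < card ({..<1::nat} \<times> {..<1::nat})" by (intro psubset_card_mono) auto
    with S show "card {e \<in> edges (augmented_grid 1 a b). ends (augmented_grid 1 a b) e \<subseteq> S} + 3 \<le> 2 * card S"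
      by simp
  qed simp
  show "planar G"
    unfolding planar_def E using inj_cylinder_grid_pos[of 1] by (auto simp: G_def)
  show "in_phi4 G" by (simp add: in_phi4_def degree_def E)
qed

text \<open>The spiral rule would make chord 0 parallel to a grid edge here, so the chords are the
  two diagonals: chord 0 is drawn inside the square, chord 1 around the back of the
  cylinder.\<close>

lemma augmented_grid_2:
  defines "a \<equiv> \<lambda>k::nat. (1::nat, 1 - k)" and "b \<equiv> \<lambda>k::nat. (0::nat, k)"
  defines "G \<equiv> augmented_grid 2 a b"
  shows "valid_chords 2 a b" "tight G" "planar G" "in_phi4 G"
proof -
  have two: "k = 0 \<or> k = 1" if "k < 2 * 2 - 2" for k :: nat using that by auto
  show v: "valid_chords 2 a b" by (auto simp: valid_chords_def a_def b_def)
  have E: "edges G = {Horiz 0 0, Horiz 1 0, Vert 0 0, Vert 0 1, Chord 0, Chord 1}"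
    by (auto simp: G_def augmented_grid_def less_2_cases_iff image_iff)
  have inj: "inj_on (ends G) (edges G)"
    unfolding E by (auto simp: G_def a_def b_def inj_on_def doubleton_eq_iff)
  show "tight G" unfolding G_def
  proof (rule tight_augmented_grid[OF _ v], fold G_def)
    fix S :: "(nat \<times> nat) set"
    assume S: "S \<subset> {..<2} \<times> {..<2}" "2 \<le> card S"
    have fin: "finite S" using S by (auto dest: finite_subset)
    have "card S < card ({..<2::nat} \<times> {..<2::nat})" using S by (intro psubset_card_mono) auto
    then have cS: "card S = 2 \<or> card S = 3" using S by (auto simp: card_cartesian_product)
    \<comment> \<open>No two edges are parallel, so \<open>S\<close> spans at most as many edges as
      it has pairs of vertices.\<close>
    have "card {e \<in> edges G. ends G e \<subseteq> S} = card (ends G ` {e \<in> edges G. ends G e \<subseteq> S})"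
      by (intro card_image[symmetric] inj_on_subset[OF inj]) auto
    also have "\<dots> \<le> card {T. T \<subseteq> S \<and> card T = 2}"
      using fin ends_augmented_grid_subset[OF v] by (intro card_mono) (auto simp: G_def)
    also have "\<dots> = card S choose 2" using fin by (rule n_subsets)
    finally show "card {e \<in> edges G. ends G e \<subseteq> S} + 3 \<le> 2 * card S"
      using cS by (auto simp: choose_two)
  qed simp
  show "in_phi4 G" unfolding in_phi4_def
  proof
    fix v assume "v \<in> verts G"
    then obtain i j where ij: "v = (i, j)" "i < 2" "j < 2" by (auto simp: G_def)
    have "{e \<in> edges G. v \<in> ends G e} \<subseteq> set [Horiz i 0, Vert 0 j, Chord 0, Chord 1]"
      unfolding E by (auto simp: G_def ij)
    then have "card {e \<in> edges G. v \<in> ends G e} \<le> card (set [Horiz i 0, Vert 0 j, Chord 0, Chord 1])"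
      by (intro card_mono) auto
    also have "\<dots> \<le> 4" by (rule order_trans[OF card_length]) simp
    finally have "card {e \<in> edges G. v \<in> ends G e} \<le> 4" .
    moreover have "{e \<in> edges G. ends G e = {v}} = {}"
      unfolding E by (auto simp: G_def a_def b_def)
    ultimately show "degree G v \<le> 4" by (simp only: degree_def card.empty add_0_right)
  qed
  define \<kappa> where "\<kappa> k = linepath (grid_pos (b k)) (grid_pos (a k) + (of_int (int k) * (4 * real 2), 0))" for k
  have \<kappa>: "\<kappa> 0 x = (0, 2 * x)" "\<kappa> (Suc 0) x = (1 + 6 * x, 1)" for x
    by (simp_all add: \<kappa>_def linepath_def grid_pos_def a_def b_def algebra_simps)
  show "planar G" unfolding G_def
  proof (rule planar_augmented_grid[OF _ v, where c = int], fold \<kappa>_def)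
    fix k :: nat assume "k < 2 * 2 - 2"
    then show "simple_path (cylinder (4 * real 2) \<circ> \<kappa> k)"
      unfolding \<kappa>_def by (intro simple_path_cylinder_linepath) (auto simp: grid_pos_def a_def b_def dest!: two)
  next
    fix k e and x y :: real
    assume k: "k < 2 * 2 - 2" and e: "e \<in> edges (augmented_grid 2 a b)" "grid_link e"
      and xy: "x \<in> {0..1}" "y \<in> {0..1}"
      and "cylinder (4 * real 2) (\<kappa> k x) = cylinder (4 * real 2) (grid_segment e y)"
    then obtain m :: int where m: "snd (\<kappa> k x) = snd (grid_segment e y)"
      "fst (\<kappa> k x) = fst (grid_segment e y) + m * 8"
      by (auto simp: cylinder_eq_iff)
    note bd = grid_segment_bounds[OF e xy(2)] grid_segment_bound[OF e xy(2)]
    from two[OF k] show "x = 0 \<or> x = 1"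
    proof
      assume k: "k = 0"
      have "fst (grid_segment e y) = 0 - real_of_int m * 8" using m(2) by (simp add: k \<kappa>)
      then have "m = 0" using bd(3) by (simp add: abs_mult)
      then have "fst (grid_segment e y) = 0" "snd (grid_segment e y) = 2 * x" using m by (simp_all add: k \<kappa>)
      moreover have "e \<in> {Horiz 0 0, Horiz 1 0, Vert 0 0, Vert 0 1}"
        using e(1)[folded G_def] e(2) unfolding E by auto
      ultimately show ?thesis
        by (auto simp: grid_segment_altdef simp del: grid_segment.simps)
    next
      assume k: "k = 1"
      have "1 + 6 * x = fst (grid_segment e y) + real_of_int m * 8" using m(2) by (simp add: k \<kappa>)
      moreover have "\<bar>fst (grid_segment e y)\<bar> \<le> 1" using bd(3) by simp
      moreover from calculation have "m = 0 \<or> m = 1" using xy by auto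
      ultimately show ?thesis using xy by auto
    qed
  next
    fix k l and x y :: real
    assume kl: "k < l" "l < 2 * 2 - 2" and xy: "x \<in> {0..1}" "y \<in> {0..1}"
      and "cylinder (4 * real 2) (\<kappa> k x) = cylinder (4 * real 2) (\<kappa> l y)"
    moreover from kl have "k = 0" "l = 1" by auto
    ultimately obtain m :: int where "fst (\<kappa> 0 x) = fst (\<kappa> 1 y) + m * 8"
      by (auto simp: cylinder_eq_iff)
    \<comment> \<open>Modulo 8 chord 0 stays at angle coordinate 0 while chord 1 runs from 1 to 7,
      so they never meet.\<close>
    then have "- real_of_int m * 8 = 1 + 6 * y" by (simp add: \<kappa>)
    then have "real_of_int (- m) * 8 = 1 + 6 * y" by simp
    with xy have "0 < - m" "- m < 1" by auto
    then show "x \<in> {0, 1} \<and> y \<in> {0, 1}" by simp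
  qed simp
qed

lemma augmented_grid_exists:
  assumes "n \<ge> 1"
  obtains a b where "valid_chords n a b" "tight (augmented_grid n a b)"
    "planar (augmented_grid n a b)" "in_phi4 (augmented_grid n a b)"
proof -
  consider "n = 1" | "n = 2" | "3 \<le> n" using assms by linarith
  then show thesis
  proof cases
    case 1
    then show ?thesis using that augmented_grid_1 by blast
  next
    case 2
    then show ?thesis using that augmented_grid_2 by blast
  next
    case 3
    show ?thesis
      using that[OF valid_chords_spiral[OF 3]] planar_spiral[OF 3] in_phi4_spiral[OF 3]
        tight_augmented_grid[OF assms valid_chords_spiral[OF 3] augmented_grid_sparse[OF 3]] by blast
  qed
qed

theorem lemma12:
  fixes n :: nat
  assumes "n \<ge> 1"
  shows "\<exists>G :: (nat, nat) mgraph.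
           multigraph G \<and> planar G \<and> primitive_divergent G \<and> in_phi4 G \<and>
           card (verts G) = card (verts (grid n)) \<and> card (verts G) = n\<^sup>2 \<and>
           loop_number G = n\<^sup>2 - 1 \<and>
           has_minor G (grid n)"
proof -
  obtain a b where ab: "valid_chords n a b" "tight (augmented_grid n a b)"
    "planar (augmented_grid n a b)" "in_phi4 (augmented_grid n a b)"
    using augmented_grid_exists[OF assms] .
  have mg: "multigraph (augmented_grid n a b)" using ab(1) by (rule multigraph_augmented_grid)
  then obtain G :: "(nat, nat) mgraph" where G: "iso (augmented_grid n a b) G"
    by (rule exists_iso_nat)
  have "tight G" using iso_tight[OF G ab(2)] .
  have "card (verts G) = card (verts (augmented_grid n a b))"
    using G by (auto simp: iso_def dest: bij_betw_same_card)
  then have card: "card (verts G) = n\<^sup>2"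
    by (simp add: card_cartesian_product power2_eq_square)
  have "has_minor G (grid n)"
    by (rule has_minor_iso[OF G mg _ augmented_grid_delete_chords]) auto
  moreover have "loop_number G = n\<^sup>2 - 1" using tight_imp_loop_number[OF \<open>tight G\<close>] card by simp
  moreover have "card (verts (grid n)) = n\<^sup>2"
    by (simp add: grid_def card_cartesian_product power2_eq_square)
  ultimately show ?thesis
    using iso_multigraph[OF G mg] iso_planar[OF G mg ab(3)] iso_in_phi4[OF G mg ab(4)]
      tight_imp_primitive_divergent[OF \<open>tight G\<close>] card by (intro exI[of _ G]) simp
qed

end
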